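(* Let $N\ge1$, $\frac12-\frac1N<\frac1p<\frac12$, let $\Omega\subset\mathbb{R}^N$ be open, let $V\in C^1(\Omega;(0,\infty))$ and $A\in C^2(\Omega;\bigwedge^1\mathbb{R}^N)$. Let $\mathcal{C}(x)=\mathcal{E}(V(x),DA(x))$ for $x\in\Omega$. If $x_*\in\Omega$ is a local minimum point of $\mathcal{C}$ and $v_*\in H^1_{V(x_* ),DA(x_* )}(\mathbb{R}^N)$ achieves $\mathcal{E}(V(x_* ),DA(x_* ))$, then $$q\,dV(x_* )+d\langle dA,\mu\rangle(x_* )=0,$$ where the charge $q\in\mathbb{R}$ and the magnetic moment $\mu\in\bigwedge^2\mathbb{R}^N$ (a constant bivector) are defined by $$q=\int_{\mathbb{R}^N}|v_*|^2,\qquad \mu=\frac12\int_{\mathbb{R}^N}\bigl(y\wedge\nabla_{DA(x_* )}v_*(y)\,\big|\,\mathrm{i}v_*(y)\bigr)\,\mathrm{d}y .$$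
   Context: $\mathbb{C}$ is regarded as a two-dimensional real Euclidean space, so scalar products $(\cdot|\cdot)$ on $\mathbb{C}$ are real. For a $1$-form $B$, $D_Bv=Dv+\mathrm{i}\,vB$. For $V_*\in(0,\infty)$ and a linear map $A_*:\mathbb{R}^N\to\bigwedge^1\mathbb{R}^N$ (regarded as a magnetic potential $y\mapsto A_*(y)$ on $\mathbb{R}^N$), $H^1_{V_*,A_*}(\mathbb{R}^N)$ is the completion of $C^1_c(\mathbb{R}^N;\mathbb{C})$ for the norm $(\int_{\mathbb{R}^N}|D_{A_*}v|^2+V_*|v|^2)^{1/2}$, $\mathcal{I}_{V_*,A_*}(v)=\frac12\int_{\mathbb{R}^N}|D_{A_*}v|^2+V_*|v|^2-\frac1p\int_{\mathbb{R}^N}|v|^p$, and $$\mathcal{E}(V_*,A_* )=\inf\{\mathcal{I}_{V_*,A_*}(v): v\in H^1_{V_*,A_*}(\mathbb{R}^N)\setminus\{0\},\ \langle\mathcal{I}'_{V_*,A_*}(v),v\rangle=0\}.$$ "$v_*$ achieves $\mathcal{E}(V_*,A_* )$" means that $v_*\ne0$, $\langle\mathcal{I}'_{V_*,A_*}(v_* ),v_*\rangle=0$ and $\mathcal{I}_{V_*,A_*}(v_* )=\mathcal{E}(V_*,A_* )$. $DA(x)$ denotes the linear map $y\mapsto DA(x)[y]$ (derivative of $A$ at $x$ in direction $y$), and $DA(x)[y,w]=(DA(x)[y])[w]$; $dA(x)[v,w]=DA(x)[v,w]-DA(x)[w,v]$. In the definition of $\mu$, $\bigl(y\wedge\nabla_{B}v(y)|\mathrm{i}v(y)\bigr)=\sum_{j=1}^N\bigl(D_{B}v(y)[e_j]\,|\,\mathrm{i}v(y)\bigr)\,y\wedge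 e_j$, with $(e_j)$ the canonical basis. The pairing of $2$-forms with bivectors uses the convention $v\wedge w=v\otimes w-w\otimes v$, i.e. $\langle\alpha,v\wedge w\rangle=\alpha[v,w]-\alpha[w,v]$. $d\langle dA,\mu\rangle$ is the differential of the scalar function $x\mapsto\langle dA(x),\mu\rangle$. *)

theory Defs
  imports "HOL-Analysis.Analysis"
begin

section \<open>Differentials and classes \<open>C\<^sup>1\<close>, \<open>C\<^sup>2\<close> on open sets\<close>

text \<open>The differential as a bounded linear map; meaningful where \<open>f\<close> is differentiable.\<close>

definition diffl :: "('a::real_normed_vector \<Rightarrow> 'b::real_normed_vector) \<Rightarrow> 'a \<Rightarrow> 'a \<Rightarrow>\<^sub>L 'b" where
  "diffl f x = Blinfun (frechet_derivative f (at x))"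

definition C1_on :: "'a::real_normed_vector set \<Rightarrow> ('a \<Rightarrow> 'b::real_normed_vector) \<Rightarrow> bool" where
  "C1_on S f \<longleftrightarrow> (\<forall>x\<in>S. f differentiable (at x)) \<and> continuous_on S (diffl f)"

definition C2_on :: "'a::real_normed_vector set \<Rightarrow> ('a \<Rightarrow> 'b::real_normed_vector) \<Rightarrow> bool" where
  "C2_on S f \<longleftrightarrow> C1_on S f \<and> C1_on S (diffl f)"

section \<open>The magnetic Sobolev space\<close>

text \<open>Covectors are elements of \<^typ>\<open>(real^'n) \<Rightarrow>\<^sub>L real\<close>. A linear magnetic potential is therefore a
  map \<open>a :: (real^'n) \<Rightarrow>\<^sub>L (real^'n) \<Rightarrow>\<^sub>L real\<close>, with \<open>a[y, w]\<close> being \<open>a y w\<close>.\<close>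

type_synonym 'n potential = "(real^'n) \<Rightarrow>\<^sub>L (real^'n) \<Rightarrow>\<^sub>L real"

text \<open>The real-linear map \<open>D\<^sub>a u(y) = Du(y) + \<i> u(y) a(y)\<close> from \<open>\<real>\<^sup>N\<close> to \<open>\<complex>\<close> is stored as the vector of its
  values on the canonical basis. Thus its norm is the Euclidean one, as it should be in
  \<open>\<integral>|D\<^sub>a u|\<^sup>2\<close>, and not the operator norm of \<^typ>\<open>(real^'n) \<Rightarrow>\<^sub>L complex\<close>.\<close>

definition cov_deriv :: "'n::finite potential \<Rightarrow> (real^'n \<Rightarrow> complex) \<Rightarrow> real^'n \<Rightarrow> complex^'n" where
  "cov_deriv a u y =
     (\<chi> j. blinfun_apply (diffl u y) (axis j 1)
          + \<i> * u y * complex_of_real (blinfun_apply (blinfun_apply a y) (axis j 1)))"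

definition C1c :: "(real^'n::finite \<Rightarrow> complex) set" where
  "C1c = {u. C1_on UNIV u \<and> (\<exists>K. compact K \<and> (\<forall>y. y \<notin> K \<longrightarrow> u y = 0))}"

definition L2 :: "(real^'n::finite \<Rightarrow> 'b::euclidean_space) set" where
  "L2 = {f. f \<in> borel_measurable lborel \<and> integrable lborel (\<lambda>y. (norm (f y))\<^sup>2)}"

text \<open>The squared norm of \<open>v\<close>, where \<open>g\<close> stands for \<open>D\<^sub>a v\<close>.\<close>

definition H1_normsq ::
  "real \<Rightarrow> (real^'n::finite \<Rightarrow> complex) \<times> (real^'n \<Rightarrow> complex^'n) \<Rightarrow> real" where
  "H1_normsq V = (\<lambda>(v, g). \<integral>y. (norm (g y))\<^sup>2 + V * (norm (v y))\<^sup>2 \<partial>lborel)"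

text \<open>The map \<open>u \<mapsto> (u, D\<^sub>a u)\<close> is an isometry of \<open>C\<^sup>1\<^sub>c\<close> into the (weighted, complete) space
  \<open>L\<^sup>2 \<times> L\<^sup>2\<close>, so the completion of \<open>C\<^sup>1\<^sub>c\<close> is the closure of its range. An element of the completion is
  represented by a pair \<open>(v, g)\<close>, in which \<open>g\<close> is \<open>D\<^sub>a v\<close>; as usual, functions that agree almost
  everywhere are different representatives of the same element. Since \<open>u \<mapsto> D\<^sub>a u\<close> is closable,
  \<open>v\<close> determines \<open>g\<close> almost everywhere.\<close>

definition H1 :: "real \<Rightarrow> 'n::finite potential
    \<Rightarrow> ((real^'n \<Rightarrow> complex) \<times> (real^'n \<Rightarrow> complex^'n)) set" where
  "H1 V a = {(v, g). v \<in> L2 \<and> g \<in> L2 \<and>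
     (\<exists>u :: nat \<Rightarrow> real^'n \<Rightarrow> complex. (\<forall>k. u k \<in> C1c) \<and>
        (\<lambda>k. H1_normsq V (\<lambda>y. u k y - v y, \<lambda>y. cov_deriv a (u k) y - g y)) \<longlonglongrightarrow> 0)}"

section \<open>The limiting functional and its ground-energy\<close>

text \<open>The potential \<open>a\<close> enters the functional only through \<open>g = D\<^sub>a v\<close>.\<close>

definition action ::
  "real \<Rightarrow> real \<Rightarrow> (real^'n::finite \<Rightarrow> complex) \<times> (real^'n \<Rightarrow> complex^'n) \<Rightarrow> real" where
  "action p V = (\<lambda>(v, g).
      1 / 2 * (\<integral>y. (norm (g y))\<^sup>2 + V * (norm (v y))\<^sup>2 \<partial>lborel)
      - 1 / p * (\<integral>y. norm (v y) powr p \<partial>lborel))"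

text \<open>\<open>\<langle>I'(v), w\<rangle>\<close>: the derivative of the functional at \<open>v\<close> in the direction \<open>w\<close>.\<close>

definition action_deriv :: "real \<Rightarrow> real
    \<Rightarrow> (real^'n::finite \<Rightarrow> complex) \<times> (real^'n \<Rightarrow> complex^'n)
    \<Rightarrow> (real^'n \<Rightarrow> complex) \<times> (real^'n \<Rightarrow> complex^'n) \<Rightarrow> real" where
  "action_deriv p V = (\<lambda>(v, g) (w, h).
      deriv (\<lambda>t::real. action p V (\<lambda>y. v y + t *\<^sub>R w y, \<lambda>y. g y + t *\<^sub>R h y)) 0)"

definition nehari :: "real \<Rightarrow> real \<Rightarrow> 'n::finite potential
    \<Rightarrow> ((real^'n \<Rightarrow> complex) \<times> (real^'n \<Rightarrow> complex^'n)) set" where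
  "nehari p V a = {(v, g). (v, g) \<in> H1 V a \<and> \<not> (AE y in lborel. v y = 0) \<and>
      action_deriv p V (v, g) (v, g) = 0}"

definition ground_energy :: "real \<Rightarrow> real \<Rightarrow> 'n::finite potential \<Rightarrow> real" where
  "ground_energy p V a = Inf (action p V ` nehari p V a)"

definition achieves_ground_energy :: "real \<Rightarrow> real \<Rightarrow> 'n::finite potential
    \<Rightarrow> (real^'n \<Rightarrow> complex) \<times> (real^'n \<Rightarrow> complex^'n) \<Rightarrow> bool" where
  "achieves_ground_energy p V a w \<longleftrightarrow>
      w \<in> nehari p V a \<and> action p V w = ground_energy p V a"

section \<open>Bivectors, charge and magnetic moment\<close>

text \<open>Bivectors are antisymmetric matrices, with \<open>v \<and> w = v \<otimes> w - w \<otimes> v\<close>.\<close>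

definition wedge :: "real^'n::finite \<Rightarrow> real^'n \<Rightarrow> real^'n^'n" where
  "wedge v w = (\<chi> i j. v $ i * w $ j - w $ i * v $ j)"

definition pairing :: "(real^'n::finite \<Rightarrow> real^'n \<Rightarrow> real) \<Rightarrow> real^'n^'n \<Rightarrow> real" where
  "pairing \<alpha> m = (\<Sum>i\<in>UNIV. \<Sum>j\<in>UNIV. \<alpha> (axis i 1) (axis j 1) * m $ i $ j)"

lemma pairing_wedge:
  fixes \<alpha> :: "real^'n::finite \<Rightarrow> real^'n \<Rightarrow> real"
  assumes "bilinear \<alpha>"
  shows "pairing \<alpha> (wedge v w) = \<alpha> v w - \<alpha> w v"
proof -
  have expand: "\<alpha> x z = (\<Sum>i\<in>UNIV. \<Sum>j\<in>UNIV. \<alpha> (axis i 1) (axis j 1) * (x $ i * z $ j))" for x z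
  proof -
    have "\<alpha> x z = \<alpha> (\<Sum>i\<in>UNIV. x $ i *\<^sub>R axis i 1) (\<Sum>j\<in>UNIV. z $ j *\<^sub>R axis j 1)"
      using basis_expansion[of x] basis_expansion[of z] by (simp add: scalar_mult_eq_scaleR)
    also have "\<dots> = (\<Sum>(i, j)\<in>UNIV \<times> UNIV. \<alpha> (x $ i *\<^sub>R axis i 1) (z $ j *\<^sub>R axis j 1))"
      by (rule bilinear_sum[OF assms])
    also have "\<dots> = (\<Sum>i\<in>UNIV. \<Sum>j\<in>UNIV. \<alpha> (axis i 1) (axis j 1) * (x $ i * z $ j))"
      by (simp add: sum.cartesian_product bilinear_lmul[OF assms] bilinear_rmul[OF assms] mult_ac)
    finally show ?thesis .
  qed
  show ?thesis
    unfolding expand[of v w] expand[of w v] pairing_def wedge_def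
    by (simp add: sum_subtractf right_diff_distrib)
qed

text \<open>The exterior derivative \<open>dA(x)[v, w] = DA(x)[v, w] - DA(x)[w, v]\<close>.\<close>

definition ext_deriv ::
  "(real^'n::finite \<Rightarrow> (real^'n) \<Rightarrow>\<^sub>L real) \<Rightarrow> real^'n \<Rightarrow> real^'n \<Rightarrow> real^'n \<Rightarrow> real" where
  "ext_deriv A x v w =
     blinfun_apply (blinfun_apply (diffl A x) v) w - blinfun_apply (blinfun_apply (diffl A x) w) v"

definition charge :: "(real^'n::finite \<Rightarrow> complex) \<Rightarrow> real" where
  "charge v = (\<integral>y. (norm (v y))\<^sup>2 \<partial>lborel)"

text \<open>Here \<open>g\<close> stands for the covariant derivative of \<open>v\<close>, and \<open>\<bullet>\<close> is the real scalar product on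
  \<open>\<complex>\<close>.\<close>

definition magnetic_moment ::
  "(real^'n::finite \<Rightarrow> complex) \<Rightarrow> (real^'n \<Rightarrow> complex^'n) \<Rightarrow> real^'n^'n" where
  "magnetic_moment v g =
     (1 / 2) *\<^sub>R (\<integral>y. (\<Sum>j\<in>UNIV. (g y $ j \<bullet> (\<i> * v y)) *\<^sub>R wedge y (axis j 1)) \<partial>lborel)"

end

theory Submission
  imports Defs
begin

text \<open>A ground-state \<open>v\<close> at \<open>x\<^sub>*\<close> is used as a test function for \<open>\<E>(V(x), DA(x))\<close> at nearby points \<open>x\<close>.
  The ground-energy is a monotone function of the quotient of \<open>\<integral>|Dw|\<^sup>2 + V|w|\<^sup>2\<close> and
  \<open>(\<integral>|w|\<^sup>p)\<^bsup>2/p\<^esup>\<close>, and only the first of these depends on \<open>x\<close>, quadratically in \<open>DA(x)\<close>. So this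
  quadratic expression in \<open>DA(x)\<close> has a local minimum at \<open>x\<^sub>*\<close>, and its differential vanishes. The
  differential contains the first moments of the current, which form an antisymmetric matrix because
  the current is divergence free; this matrix is the magnetic moment.

  The moments exist because \<open>|y| v(y)\<close> is square integrable. This follows from an energy estimate with
  weights \<open>y\<^sub>i / (1 + \<epsilon>|y|\<^sup>2)\<close>, in which the Sobolev inequality is not an external input: minimality of
  \<open>v\<close> is that inequality, with its optimal constant.\<close>

section \<open>Gradients and the magnetic potential\<close>

text \<open>The ground-energy is an infimum, and near \<open>xs\<close> neither its
  differentiability nor the existence of minimizers is given; what gets differentiated is the value
  of one fixed competitor. The obstacle is that the magnetic spaces at different points differ: the
  potential grows linearly, so \<open>v\<close> is carried into the space at a neighbouring point
  through the square integrability of |y| v, a decay that is not among the hypotheses. All of it is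
  won from multiplications of \<open>v\<close> by bounded C^1 functions \<theta> with bounded
  gradient, which act on spaces defined as closures, and the L^p term is never differentiated under
  the integral. An imaginary \<theta> cannot decrease |v| to either side, which yields an equation;
  a real \<theta> is used only to shrink |v|, where Bernoulli's inequality suffices, which yields an
  inequality. The equation, tested with products of two coordinates, gives the antisymmetry of the
  moments; the inequality, tested with squares of weights, gives the decay.\<close>

definition has_grad :: "(real^'n::finite \<Rightarrow> complex) \<Rightarrow> (real^'n \<Rightarrow> complex^'n) \<Rightarrow> bool" where
  "has_grad f G \<longleftrightarrow> continuous_on UNIV G \<and>
     (\<forall>y. (f has_derivative (\<lambda>h. \<Sum>j\<in>UNIV. h $ j *\<^sub>R G y $ j)) (at y))"

text \<open>The magnetic summand of \<open>cov_deriv\<close> with \<open>u\<close> split off: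
  replacing \<open>a\<close> by \<open>a + b\<close> turns the pair \<open>(v, g)\<close> into
  \<open>v\<close> and \<open>g y + v y *s potvec b y\<close>.\<close>

definition potvec :: "'n::finite potential \<Rightarrow> real^'n \<Rightarrow> complex^'n" where
  "potvec a y = (\<chi> j. \<i> * complex_of_real (blinfun_apply (blinfun_apply a y) (axis j 1)))"

lemma potvec_add: "potvec (a + b) y = potvec a y + potvec b y"
  by (simp add: potvec_def vec_eq_iff blinfun.add_left distrib_left)

lemma potvec_zero [simp]: "potvec 0 y = 0"
  by (simp add: potvec_def vec_eq_iff)

lemma norm_smult: "norm (c *s x) = norm c * norm (x :: complex^'n::finite)"
  by (simp add: norm_vec_def norm_mult L2_set_right_distrib)

lemma bounded_bilinear_smult: "bounded_bilinear ((*s) :: complex \<Rightarrow> complex^'n::finite \<Rightarrow> complex^'n)"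
  by (standard; (rule exI[of _ 1])?)
     (auto simp: vec_eq_iff algebra_simps norm_smult)

lemmas continuous_on_smult [continuous_intros] =
  bounded_bilinear.continuous_on [OF bounded_bilinear_smult]

lemma borel_measurable_smult [measurable (raw)]:
  fixes g :: "'a \<Rightarrow> complex^'n::finite"
  assumes "c \<in> borel_measurable M" "g \<in> borel_measurable M"
  shows "(\<lambda>y. c y *s g y) \<in> borel_measurable M"
  using assms by (rule borel_measurable_continuous_Pair) (intro continuous_intros)

lemma borel_measurable_vec_nth [measurable (raw)]:
  fixes g :: "'a \<Rightarrow> ('b::second_countable_topology)^'n::finite"
  assumes "g \<in> borel_measurable M"
  shows "(\<lambda>y. g y $ j) \<in> borel_measurable M"
  by (rule measurable_compose[OF assms borel_measurable_continuous_onI]) (intro continuous_intros)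

text \<open>Only the linear growth in \<open>y\<close> matters; the factor \<open>CARD('n)\<close>
  comes from the crude comparison of the Euclidean norm with the sum of the components.\<close>

lemma norm_potvec_le: "norm (potvec (a :: 'n::finite potential) y) \<le> real CARD('n) * norm a * norm y"
proof -
  have "norm (potvec a y) \<le> (\<Sum>j\<in>UNIV. norm (potvec a y $ j))"
    by (simp add: norm_vec_def L2_set_le_sum)
  also have "\<dots> \<le> (\<Sum>j\<in>(UNIV::'n set). norm a * norm y)"
  proof (rule sum_mono)
    fix j
    have "norm (potvec a y $ j) \<le> norm (blinfun_apply a y) * norm (axis j (1::real))"
      using norm_blinfun[of "blinfun_apply a y" "axis j 1"] by (simp add: potvec_def norm_mult)
    also have "\<dots> \<le> norm a * norm y"
      using norm_blinfun[of a y] by simp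
    finally show "norm (potvec a y $ j) \<le> norm a * norm y" .
  qed
  finally show ?thesis by simp
qed

lemma continuous_on_potvec [continuous_intros]: "continuous_on S (potvec a)"
  unfolding potvec_def by (intro continuous_intros)

lemma borel_measurable_potvec [measurable]: "potvec a \<in> borel_measurable borel"
  by (rule borel_measurable_continuous_onI) (rule continuous_on_potvec)

lemma has_gradD:
  assumes "has_grad f G"
  shows "(f has_derivative (\<lambda>h. \<Sum>j\<in>UNIV. h $ j *\<^sub>R G y $ j)) (at y)" "continuous_on UNIV G"
    "continuous_on UNIV f" 
  using assms unfolding has_grad_def
  by (auto intro!: continuous_at_imp_continuous_on has_derivative_continuous)

lemma has_grad_measurable:
  assumes "has_grad f G"
  shows "f \<in> borel_measurable borel" "G \<in> borel_measurable borel"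
  using has_gradD[OF assms] by (auto intro: borel_measurable_continuous_onI)

lemma has_derivative_diffl:
  assumes "f differentiable at x"
  shows "(f has_derivative blinfun_apply (diffl f x)) (at x)"
  using assms frechet_derivative_works[of f "at x"]
  by (simp add: diffl_def has_derivative_bounded_linear bounded_linear_Blinfun_apply)

lemma diffl_unique:
  assumes "(f has_derivative f') (at x)"
  shows "blinfun_apply (diffl f x) = f'"
  using assms frechet_derivative_at[OF assms]
  by (simp add: diffl_def has_derivative_bounded_linear bounded_linear_Blinfun_apply)

lemma has_grad_diffl:
  assumes "has_grad f G"
  shows "blinfun_apply (diffl f y) (axis j 1) = G y $ j"
proof -
  have "(\<Sum>i\<in>UNIV. axis j (1::real) $ i *\<^sub>R G y $ i) = (\<Sum>i\<in>UNIV. if i = j then G y $ i else 0)"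
    by (intro sum.cong) (auto simp: axis_def)
  then show ?thesis
    using diffl_unique[OF has_gradD(1)[OF assms]] by simp
qed

lemma cov_deriv_has_grad: "has_grad f G \<Longrightarrow> cov_deriv a f y = G y + f y *s potvec a y"
  by (simp add: cov_deriv_def has_grad_diffl potvec_def vec_eq_iff)

text \<open>For the converse, continuity of the differential in operator norm can be tested on basis
  vectors, the domain being finite-dimensional.\<close>

lemma C1_on_iff_has_grad: "C1_on UNIV f \<longleftrightarrow> (\<exists>G. has_grad f G)"
proof
  assume f: "C1_on UNIV f"
  let ?G = "\<lambda>y. \<chi> j. blinfun_apply (diffl f y) (axis j 1)"
  have "has_grad f ?G"
    unfolding has_grad_def
  proof (intro conjI allI)
    show "continuous_on UNIV ?G"
      using f unfolding C1_on_def by (intro continuous_intros) auto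
  next
    fix y
    have "blinfun_apply (diffl f y) h = (\<Sum>j\<in>UNIV. h $ j *\<^sub>R ?G y $ j)" for h
    proof -
      have "h = (\<Sum>j\<in>UNIV. h $ j *\<^sub>R axis j 1)"
        using basis_expansion[of h] by (simp add: scalar_mult_eq_scaleR)
      then have "blinfun_apply (diffl f y) h = blinfun_apply (diffl f y) (\<Sum>j\<in>UNIV. h $ j *\<^sub>R axis j 1)"
        by simp
      then show ?thesis by (simp add: blinfun.sum_right blinfun.scaleR_right)
    qed
    then show "(f has_derivative (\<lambda>h. \<Sum>j\<in>UNIV. h $ j *\<^sub>R ?G y $ j)) (at y)"
      using has_derivative_diffl[of f y] f unfolding C1_on_def by (metis (no_types, lifting) ext UNIV_I)
  qed
  then show "\<exists>G. has_grad f G" by blast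
next
  assume "\<exists>G. has_grad f G"
  then obtain G where G: "has_grad f G" by blast
  have "continuous_on UNIV (\<lambda>y. blinfun_apply (diffl f y) i)" if "i \<in> Basis" for i
  proof -
    obtain j where "i = axis j 1" using \<open>i \<in> Basis\<close> by (auto simp: Basis_vec_def)
    then show ?thesis using has_gradD(2)[OF G] by (auto simp: has_grad_diffl[OF G] intro!: continuous_intros)
  qed
  then show "C1_on UNIV f"
    unfolding C1_on_def using has_gradD(1)[OF G]
    by (auto simp: differentiable_def intro!: continuous_blinfun_componentwiseI1 continuous_on_blinfun_componentwise)
qed

lemma has_grad_const: "has_grad (\<lambda>y. c) (\<lambda>y. 0)"
  by (auto simp: has_grad_def)

lemma has_grad_coord: "has_grad (\<lambda>y::real^'n::finite. complex_of_real (y $ i)) (\<lambda>y. axis i 1)"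
proof -
  have "(\<Sum>j\<in>UNIV. h $ j *\<^sub>R axis i (1::complex) $ j) = complex_of_real (h $ i)" for h :: "real^'n"
  proof -
    have "(\<Sum>j\<in>UNIV. h $ j *\<^sub>R axis i (1::complex) $ j) = (\<Sum>j\<in>UNIV. if j = i then complex_of_real (h $ j) else 0)"
      by (intro sum.cong) (auto simp: axis_def scaleR_conv_of_real)
    then show ?thesis by simp
  qed
  moreover have "((\<lambda>y::real^'n. complex_of_real (y $ i)) has_derivative (\<lambda>h. complex_of_real (h $ i))) (at y)" for y
    by (intro bounded_linear_imp_has_derivative bounded_linear_compose[OF bounded_linear_of_real bounded_linear_vec_nth])
  ultimately show ?thesis by (simp add: has_grad_def)
qed

text \<open>Multipliers are complex-valued throughout, so that real weights and purely imaginary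
  phases obey one product rule.\<close>

lemma has_grad_mult:
  assumes "has_grad f F" "has_grad g G"
  shows "has_grad (\<lambda>y. f y * g y) (\<lambda>y. f y *s G y + g y *s F y)"
  unfolding has_grad_def
proof (intro conjI allI)
  show "continuous_on UNIV (\<lambda>y. f y *s G y + g y *s F y)"
    using has_gradD[OF assms(1)] has_gradD[OF assms(2)] by (intro continuous_intros)
next
  fix y
  show "((\<lambda>y. f y * g y) has_derivative (\<lambda>h. \<Sum>j\<in>UNIV. h $ j *\<^sub>R (f y *s G y + g y *s F y) $ j)) (at y)"
    by (rule has_derivative_eq_rhs[OF has_derivative_mult[OF has_gradD(1)[OF assms(1)] has_gradD(1)[OF assms(2)]]])
       (simp add: fun_eq_iff sum_distrib_left sum_distrib_right sum.distrib[symmetric] algebra_simps)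
qed

lemma has_grad_add:
  assumes "has_grad f F" "has_grad g G"
  shows "has_grad (\<lambda>y. f y + g y) (\<lambda>y. F y + G y)"
  unfolding has_grad_def
proof (intro conjI allI)
  show "continuous_on UNIV (\<lambda>y. F y + G y)"
    using has_gradD[OF assms(1)] has_gradD[OF assms(2)] by (intro continuous_intros)
next
  fix y
  show "((\<lambda>y. f y + g y) has_derivative (\<lambda>h. \<Sum>j\<in>UNIV. h $ j *\<^sub>R (F y + G y) $ j)) (at y)"
    by (rule has_derivative_eq_rhs[OF has_derivative_add[OF has_gradD(1)[OF assms(1)] has_gradD(1)[OF assms(2)]]])
       (simp add: fun_eq_iff sum.distrib[symmetric] algebra_simps)
qed

lemma has_grad_inverse:
  assumes "has_grad f F" "\<And>y. f y \<noteq> 0"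
  shows "has_grad (\<lambda>y. inverse (f y)) (\<lambda>y. - ((inverse (f y))\<^sup>2 *s F y))"
  unfolding has_grad_def
proof (intro conjI allI)
  show "continuous_on UNIV (\<lambda>y. - ((inverse (f y))\<^sup>2 *s F y))"
    using has_gradD[OF assms(1)] assms(2) by (intro continuous_intros) auto
next
  fix y
  show "((\<lambda>y. inverse (f y)) has_derivative (\<lambda>h. \<Sum>j\<in>UNIV. h $ j *\<^sub>R (- ((inverse (f y))\<^sup>2 *s F y)) $ j)) (at y)"
    by (rule has_derivative_eq_rhs[OF Deriv.has_derivative_inverse[OF assms(2) has_gradD(1)[OF assms(1)]]])
       (simp add: fun_eq_iff sum_distrib_left sum_distrib_right sum_negf power2_eq_square algebra_simps)
qed

lemma has_grad_sum:
  assumes "\<And>i. i \<in> I \<Longrightarrow> has_grad (f i) (F i)"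
  shows "has_grad (\<lambda>y. \<Sum>i\<in>I. f i y) (\<lambda>y. \<Sum>i\<in>I. F i y)"
  using assms
  by (induction I rule: infinite_finite_induct) (auto intro: has_grad_const has_grad_add)

lemma has_grad_normsq:
  "has_grad (\<lambda>y::real^'n::finite. complex_of_real ((norm y)\<^sup>2)) (\<lambda>y. 2 *s (\<chi> i. complex_of_real (y $ i)))"
proof -
  have "has_grad (\<lambda>y::real^'n. \<Sum>i\<in>UNIV. complex_of_real (y $ i) * complex_of_real (y $ i))
     (\<lambda>y. \<Sum>i\<in>UNIV. complex_of_real (y $ i) *s axis i 1 + complex_of_real (y $ i) *s axis i 1)"
    by (intro has_grad_sum has_grad_mult has_grad_coord)
  moreover have "(\<lambda>y::real^'n. \<Sum>i\<in>UNIV. complex_of_real (y $ i) * complex_of_real (y $ i)) = (\<lambda>y. complex_of_real ((norm y)\<^sup>2))"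
    by (simp add: power2_norm_eq_inner inner_vec_def fun_eq_iff)
  moreover have "(\<Sum>i\<in>UNIV. complex_of_real (y $ i) *s axis i 1 + complex_of_real (y $ i) *s axis i 1)
     = 2 *s (\<chi> i. complex_of_real (y $ i))" for y :: "real^'n"
    using basis_expansion[of "\<chi> i. complex_of_real (y $ i)"] by (simp add: sum.distrib vec_eq_iff flip: sum_distrib_left)
  ultimately show ?thesis by (simp only:)
qed

section \<open>Square integrable functions and the magnetic Sobolev space\<close>

lemma L2_I:
  assumes "f \<in> borel_measurable borel" "integrable lborel (\<lambda>y. (norm (f y))\<^sup>2)"
  shows "f \<in> L2"
  using assms by (simp add: L2_def)

lemma L2_measurable: "f \<in> L2 \<Longrightarrow> f \<in> borel_measurable borel"
  by (simp add: L2_def)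

lemma L2_integrable: "f \<in> L2 \<Longrightarrow> integrable lborel (\<lambda>y. (norm (f y))\<^sup>2)"
  by (simp add: L2_def)

lemma L2_dominated:
  assumes "f \<in> L2" "F \<in> borel_measurable borel" "\<And>y. norm (F y) \<le> K * norm (f y)"
  shows "F \<in> L2"
proof (rule L2_I)
  have "integrable lborel (\<lambda>y. K\<^sup>2 * (norm (f y))\<^sup>2)"
    using L2_integrable[OF assms(1)] by simp
  then show "integrable lborel (\<lambda>y. (norm (F y))\<^sup>2)"
  proof (rule Bochner_Integration.integrable_bound)
    show "(\<lambda>y. (norm (F y))\<^sup>2) \<in> borel_measurable lborel"
      using assms(2) by simp
    show "AE y in lborel. norm ((norm (F y))\<^sup>2) \<le> norm (K\<^sup>2 * (norm (f y))\<^sup>2)"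
    proof (rule AE_I2)
      fix y
      have "(norm (F y))\<^sup>2 \<le> (K * norm (f y))\<^sup>2"
        using assms(3)[of y] by (intro power_mono) auto
      then show "norm ((norm (F y))\<^sup>2) \<le> norm (K\<^sup>2 * (norm (f y))\<^sup>2)"
        by (simp add: power_mult_distrib)
    qed
  qed
qed (rule assms(2))

lemma norm_add_sq_le: "(norm (x + y))\<^sup>2 \<le> 2 * (norm x)\<^sup>2 + 2 * (norm (y :: 'a::real_normed_vector))\<^sup>2"
proof -
  have "(norm (x + y))\<^sup>2 \<le> (norm x + norm y)\<^sup>2"
    by (intro power_mono norm_triangle_ineq) simp
  also have "\<dots> \<le> 2 * (norm x)\<^sup>2 + 2 * (norm y)\<^sup>2"
    using sum_squares_bound[of "norm x" "norm y"] by (simp add: power2_sum)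
  finally show ?thesis .
qed

lemma L2_add:
  assumes "f \<in> L2" "g \<in> L2"
  shows "(\<lambda>y. f y + g y) \<in> L2"
proof (rule L2_I)
  have "integrable lborel (\<lambda>y. 2 * (norm (f y))\<^sup>2 + 2 * (norm (g y))\<^sup>2)"
    using L2_integrable[OF assms(1)] L2_integrable[OF assms(2)] by simp
  then show "integrable lborel (\<lambda>y. (norm (f y + g y))\<^sup>2)"
    by (rule Bochner_Integration.integrable_bound)
       (use assms[THEN L2_measurable] norm_add_sq_le in \<open>auto simp: add_nonneg_nonneg\<close>)
qed (use assms[THEN L2_measurable] in simp)

lemma L2_scaleR: "f \<in> L2 \<Longrightarrow> (\<lambda>y. c *\<^sub>R f y) \<in> L2"
  by (rule L2_dominated[where K = "\<bar>c\<bar>"]) (auto dest: L2_measurable)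

lemma L2_diff: "f \<in> L2 \<Longrightarrow> g \<in> L2 \<Longrightarrow> (\<lambda>y. f y - g y) \<in> L2"
  using L2_add[of f "\<lambda>y. (-1) *\<^sub>R g y"] L2_scaleR[of g "-1"] by simp

lemma L2_mult:
  fixes f :: "real^'n::finite \<Rightarrow> complex"
  assumes "f \<in> L2" "\<eta> \<in> borel_measurable borel" "\<And>y. norm (\<eta> y) \<le> K"
  shows "(\<lambda>y. \<eta> y * f y) \<in> L2"
  by (rule L2_dominated[OF assms(1), where K = K])
     (use assms L2_measurable[OF assms(1)] in \<open>auto simp: norm_mult intro!: mult_right_mono\<close>)

lemma L2_smult:
  fixes f :: "real^'n::finite \<Rightarrow> complex^'n"
  assumes "f \<in> L2" "\<eta> \<in> borel_measurable borel" "\<And>y. norm (\<eta> y) \<le> K"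
  shows "(\<lambda>y. \<eta> y *s f y) \<in> L2"
  by (rule L2_dominated[OF assms(1), where K = K])
     (use assms L2_measurable[OF assms(1)] in \<open>auto simp: norm_smult intro!: mult_right_mono\<close>)

lemma L2_smult_vec:
  fixes f :: "real^'n::finite \<Rightarrow> complex" and G :: "real^'n \<Rightarrow> complex^'n"
  assumes "f \<in> L2" "G \<in> borel_measurable borel" "\<And>y. norm (G y) \<le> K"
  shows "(\<lambda>y. f y *s G y) \<in> L2"
  by (rule L2_dominated[OF assms(1), where K = K])
     (use assms L2_measurable[OF assms(1)] in \<open>auto simp: norm_smult mult.commute[of K] intro!: mult_left_mono\<close>)

lemma L2_integrable_norm_mult:
  assumes "f \<in> L2" "g \<in> L2"
  shows "integrable lborel (\<lambda>y. norm (f y) * norm (g y))"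
proof -
  have "integrable lborel (\<lambda>y. (norm (f y))\<^sup>2 + (norm (g y))\<^sup>2)"
    using L2_integrable[OF assms(1)] L2_integrable[OF assms(2)] by simp
  then show ?thesis
  proof (rule Bochner_Integration.integrable_bound)
    show "AE y in lborel. norm (norm (f y) * norm (g y)) \<le> norm ((norm (f y))\<^sup>2 + (norm (g y))\<^sup>2)"
    proof (rule AE_I2)
      fix y
      have "2 * (norm (f y) * norm (g y)) \<le> (norm (f y))\<^sup>2 + (norm (g y))\<^sup>2"
        using sum_squares_bound[of "norm (f y)" "norm (g y)"] by simp
      moreover have "0 \<le> norm (f y) * norm (g y)" by simp
      ultimately show "norm (norm (f y) * norm (g y)) \<le> norm ((norm (f y))\<^sup>2 + (norm (g y))\<^sup>2)"
        by (simp only: real_norm_def)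
    qed
  qed (use assms[THEN L2_measurable] in simp)
qed

lemma L2_integrable_inner:
  assumes "f \<in> L2" "g \<in> L2"
  shows "integrable lborel (\<lambda>y. f y \<bullet> g y)"
  by (rule Bochner_Integration.integrable_bound[OF L2_integrable_norm_mult[OF assms]])
     (use assms[THEN L2_measurable] Cauchy_Schwarz_ineq2 in auto)

lemma H1_normsq_eq:
  assumes "v \<in> L2" "g \<in> L2"
  shows "H1_normsq V (v, g) = (\<integral>y. (norm (g y))\<^sup>2 \<partial>lborel) + V * (\<integral>y. (norm (v y))\<^sup>2 \<partial>lborel)"
  using assms[THEN L2_integrable] by (simp add: H1_normsq_def)

lemma H1_normsq_nonneg: "V > 0 \<Longrightarrow> H1_normsq V w \<ge> 0"
  by (auto simp: H1_normsq_def split_beta intro!: integral_nonneg_AE)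

text \<open>Different weights give equivalent norms, whence membership in \<open>H1 V a\<close> will
  not depend on \<open>V\<close>.\<close>

lemma H1_normsq_compare:
  assumes "v \<in> L2" "g \<in> L2" "V > 0" "W > 0"
  shows "H1_normsq V (v, g) \<le> max 1 (V / W) * H1_normsq W (v, g)"
proof -
  let ?a = "\<integral>y. (norm (g y))\<^sup>2 \<partial>lborel" and ?b = "\<integral>y. (norm (v y))\<^sup>2 \<partial>lborel"
  have "?a \<ge> 0" "?b \<ge> 0" by simp_all
  have "?a \<le> max 1 (V / W) * ?a"
    using mult_right_mono[OF _ \<open>?a \<ge> 0\<close>, of 1 "max 1 (V / W)"] by simp
  moreover have "V * ?b \<le> max 1 (V / W) * (W * ?b)"
    using mult_right_mono[OF _ mult_nonneg_nonneg[OF _ \<open>?b \<ge> 0\<close>], of "V / W" "max 1 (V / W)" W] \<open>W > 0\<close> by simp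
  ultimately show ?thesis
    by (simp add: H1_normsq_eq assms distrib_left)
qed

lemma H1_normsq_add_le:
  assumes "v \<in> L2" "g \<in> L2" "w \<in> L2" "h \<in> L2" "V > 0"
  shows "H1_normsq V (\<lambda>y. v y + w y, \<lambda>y. g y + h y) \<le> 2 * H1_normsq V (v, g) + 2 * H1_normsq V (w, h)"
proof -
  have le: "(\<integral>y. (norm (f y + k y))\<^sup>2 \<partial>lborel) \<le> 2 * (\<integral>y. (norm (f y))\<^sup>2 \<partial>lborel) + 2 * (\<integral>y. (norm (k y))\<^sup>2 \<partial>lborel)"
    if "f \<in> L2" "k \<in> L2" for f k :: "real^'n \<Rightarrow> 'b::euclidean_space"
  proof -
    have "(\<integral>y. (norm (f y + k y))\<^sup>2 \<partial>lborel) \<le> (\<integral>y. 2 * (norm (f y))\<^sup>2 + 2 * (norm (k y))\<^sup>2 \<partial>lborel)"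
      using that[THEN L2_integrable] L2_integrable[OF L2_add[OF that]]
      by (intro integral_mono norm_add_sq_le) auto
    then show ?thesis using that[THEN L2_integrable] by simp
  qed
  have "V * (\<integral>y. (norm (v y + w y))\<^sup>2 \<partial>lborel) \<le> V * (2 * (\<integral>y. (norm (v y))\<^sup>2 \<partial>lborel) + 2 * (\<integral>y. (norm (w y))\<^sup>2 \<partial>lborel))"
    using le[of v w] assms by (intro mult_left_mono) auto
  then show ?thesis
    using le[of g h] assms by (simp add: H1_normsq_eq L2_add algebra_simps)
qed

lemma C1c_has_grad:
  assumes "u \<in> C1c"
  obtains G K where "has_grad u G" "compact K" "\<And>y. y \<notin> K \<Longrightarrow> u y = 0" "\<And>y. y \<notin> K \<Longrightarrow> G y = 0"
proof -
  from assms obtain G K where G: "has_grad u G" and K: "compact K" "\<forall>y. y \<notin> K \<longrightarrow> u y = 0"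
    by (auto simp: C1c_def C1_on_iff_has_grad)
  have "G y = 0" if "y \<notin> K" for y
  proof -
    have "open (- K)" using K(1) by (simp add: compact_imp_closed open_Compl)
    moreover have "y \<in> - K" using that by simp
    ultimately have "(u has_derivative (\<lambda>h. 0)) (at y)"
      by (rule has_derivative_transform_within_open[OF has_derivative_const]) (use K(2) in auto)
    then have "blinfun_apply (diffl u y) = (\<lambda>h. 0)" by (rule diffl_unique)
    then show ?thesis
      using has_grad_diffl[OF G, of y] by (simp add: vec_eq_iff)
  qed
  with G K that show ?thesis by blast
qed

lemma compact_support_L2:
  fixes f :: "real^'n::finite \<Rightarrow> 'b::euclidean_space"
  assumes "continuous_on UNIV f" "compact K" "\<And>y. y \<notin> K \<Longrightarrow> f y = 0"
  shows "f \<in> L2"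
proof (rule L2_I)
  show "f \<in> borel_measurable borel"
    using assms(1) by (rule borel_measurable_continuous_onI)
  have "integrable lborel (\<lambda>y. indicator K y *\<^sub>R (norm (f y))\<^sup>2)"
    by (rule borel_integrable_compact[OF assms(2)]) (intro continuous_intros continuous_on_subset[OF assms(1)], simp)
  moreover have "indicator K y *\<^sub>R (norm (f y))\<^sup>2 = (norm (f y))\<^sup>2" for y
    using assms(3)[of y] by (cases "y \<in> K") auto
  ultimately show "integrable lborel (\<lambda>y. (norm (f y))\<^sup>2)" by (simp only:)
qed

lemma C1c_L2:
  assumes "u \<in> C1c"
  shows "u \<in> L2" "cov_deriv a u \<in> L2"
proof -
  from C1c_has_grad[OF assms] obtain G K where
    G: "has_grad u G" and K: "compact K" "\<And>y. y \<notin> K \<Longrightarrow> u y = 0" "\<And>y. y \<notin> K \<Longrightarrow> G y = 0" by blast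
  show "u \<in> L2"
    using has_gradD(3)[OF G] K(1,2) by (rule compact_support_L2)
  have "continuous_on UNIV (\<lambda>y. G y + u y *s potvec a y)"
    using has_gradD[OF G] by (intro continuous_intros)
  then have "(\<lambda>y. G y + u y *s potvec a y) \<in> L2"
    by (rule compact_support_L2[OF _ K(1)]) (simp add: K)
  then show "cov_deriv a u \<in> L2"
    by (simp add: cov_deriv_has_grad[OF G, abs_def])
qed

lemma C1c_mult:
  assumes "u \<in> C1c" "has_grad \<eta> E"
  shows "(\<lambda>y. \<eta> y * u y) \<in> C1c"
    and "cov_deriv (a + b) (\<lambda>y. \<eta> y * u y) y = \<eta> y *s cov_deriv a u y + u y *s E y + (\<eta> y * u y) *s potvec b y"
proof -
  from C1c_has_grad[OF assms(1)] obtain G K where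
    G: "has_grad u G" and K: "compact K" "\<And>y. y \<notin> K \<Longrightarrow> u y = 0" by metis
  note M = has_grad_mult[OF assms(2) G]
  show "(\<lambda>y. \<eta> y * u y) \<in> C1c"
    using M K by (auto simp: C1c_def C1_on_iff_has_grad)
  show "cov_deriv (a + b) (\<lambda>y. \<eta> y * u y) y = \<eta> y *s cov_deriv a u y + u y *s E y + (\<eta> y * u y) *s potvec b y"
    by (simp add: cov_deriv_has_grad[OF G] cov_deriv_has_grad[OF M] potvec_add vec_eq_iff algebra_simps)
qed

text \<open>The right-hand side has weight 1 whatever \<open>V\<close> is, so passing from the space
  at \<open>xs\<close> to the one at \<open>x\<close> concerns the potential alone. An approximant
  for every error is also easier to transform than a sequence.\<close>

lemma H1_iff:
  assumes "V > 0"
  shows "(v, g) \<in> H1 V a \<longleftrightarrow> v \<in> L2 \<and> g \<in> L2 \<and>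
    (\<forall>e>0. \<exists>u\<in>C1c. H1_normsq 1 (\<lambda>y. u y - v y, \<lambda>y. cov_deriv a u y - g y) < e)" (is "?L \<longleftrightarrow> ?R")
proof
  assume ?L
  then obtain u where L2: "v \<in> L2" "g \<in> L2" and u: "\<And>k. u k \<in> C1c"
    and lim: "(\<lambda>k. H1_normsq V (\<lambda>y. u k y - v y, \<lambda>y. cov_deriv a (u k) y - g y)) \<longlonglongrightarrow> 0"
    by (auto simp: H1_def)
  have "\<exists>u\<in>C1c. H1_normsq 1 (\<lambda>y. u y - v y, \<lambda>y. cov_deriv a u y - g y) < e" if "e > 0" for e
  proof -
    define M where "M = max 1 (1 / V)"
    have "M > 0" by (simp add: M_def)
    then have "e / M > 0" using that by simp
    with lim have "\<forall>\<^sub>F k in sequentially. H1_normsq V (\<lambda>y. u k y - v y, \<lambda>y. cov_deriv a (u k) y - g y) < e / M"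
      by (rule order_tendstoD)
    then obtain k where k: "H1_normsq V (\<lambda>y. u k y - v y, \<lambda>y. cov_deriv a (u k) y - g y) < e / M"
      by (auto simp: eventually_sequentially)
    have "H1_normsq 1 (\<lambda>y. u k y - v y, \<lambda>y. cov_deriv a (u k) y - g y)
        \<le> M * H1_normsq V (\<lambda>y. u k y - v y, \<lambda>y. cov_deriv a (u k) y - g y)"
      unfolding M_def using assms L2 C1c_L2[OF u] by (intro H1_normsq_compare L2_diff) auto
    also have "\<dots> < e" using k \<open>M > 0\<close> by (simp add: field_simps)
    finally show ?thesis using u by blast
  qed
  with L2 show ?R by blast
next
  assume R: ?R
  then have "\<forall>k::nat. \<exists>u\<in>C1c. H1_normsq 1 (\<lambda>y. u y - v y, \<lambda>y. cov_deriv a u y - g y) < 1 / real (Suc k)"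
    by (auto simp del: of_nat_Suc)
  then obtain u where u: "\<And>k. u k \<in> C1c"
    and lt: "\<And>k. H1_normsq 1 (\<lambda>y. u k y - v y, \<lambda>y. cov_deriv a (u k) y - g y) < 1 / real (Suc k)"
    by metis
  have "(\<lambda>k. H1_normsq V (\<lambda>y. u k y - v y, \<lambda>y. cov_deriv a (u k) y - g y)) \<longlonglongrightarrow> 0"
  proof (rule tendsto_sandwich[OF always_eventually always_eventually])
    show "\<forall>k. 0 \<le> H1_normsq V (\<lambda>y. u k y - v y, \<lambda>y. cov_deriv a (u k) y - g y)"
      using H1_normsq_nonneg[OF assms] by blast
    show "\<forall>k. H1_normsq V (\<lambda>y. u k y - v y, \<lambda>y. cov_deriv a (u k) y - g y) \<le> max 1 V * (1 / real (Suc k))"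
    proof
      fix k
      have "H1_normsq V (\<lambda>y. u k y - v y, \<lambda>y. cov_deriv a (u k) y - g y)
        \<le> max 1 (V / 1) * H1_normsq 1 (\<lambda>y. u k y - v y, \<lambda>y. cov_deriv a (u k) y - g y)"
        using assms R C1c_L2[OF u] by (intro H1_normsq_compare L2_diff) auto
      also have "\<dots> \<le> max 1 V * (1 / real (Suc k))"
        unfolding div_by_1 by (intro mult_left_mono less_imp_le[OF lt]) auto
      finally show "H1_normsq V (\<lambda>y. u k y - v y, \<lambda>y. cov_deriv a (u k) y - g y) \<le> max 1 V * (1 / real (Suc k))" .
    qed
    show "(\<lambda>k. max 1 V * (1 / real (Suc k))) \<longlonglongrightarrow> 0"
      by (rule tendsto_mult_right_zero[OF lim_1_over_n[THEN LIMSEQ_Suc]])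
  qed simp
  with R u show ?L by (auto simp: H1_def)
qed

lemma H1_L2: "(v, g) \<in> H1 V a \<Longrightarrow> v \<in> L2" "(v, g) \<in> H1 V a \<Longrightarrow> g \<in> L2"
  by (auto simp: H1_def)

text \<open>Allows approximation by pairs of the space that do not come from \<open>C1c\<close>,
  such as cutoffs of a given pair.\<close>

lemma H1_closed:
  assumes "V > 0" "v \<in> L2" "g \<in> L2" "\<And>k. (w k, h k) \<in> H1 V a"
    and "(\<lambda>k. H1_normsq 1 (\<lambda>y. w k y - v y, \<lambda>y. h k y - g y)) \<longlonglongrightarrow> 0"
  shows "(v, g) \<in> H1 V a"
  unfolding H1_iff[OF assms(1)]
proof (intro conjI allI impI assms(2,3))
  fix e :: real assume "e > 0"
  then have "\<forall>\<^sub>F k in sequentially. H1_normsq 1 (\<lambda>y. w k y - v y, \<lambda>y. h k y - g y) < e / 4"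
    by (intro order_tendstoD[OF assms(5)]) simp
  then obtain k where k: "H1_normsq 1 (\<lambda>y. w k y - v y, \<lambda>y. h k y - g y) < e / 4"
    by (auto simp: eventually_sequentially)
  have "e / 4 > 0" using \<open>e > 0\<close> by simp
  then obtain u where u: "u \<in> C1c"
    and lt: "H1_normsq 1 (\<lambda>y. u y - w k y, \<lambda>y. cov_deriv a u y - h k y) < e / 4"
    using assms(4)[of k] unfolding H1_iff[OF assms(1)] by blast
  have "H1_normsq 1 (\<lambda>y. (u y - w k y) + (w k y - v y), \<lambda>y. (cov_deriv a u y - h k y) + (h k y - g y))
     \<le> 2 * H1_normsq 1 (\<lambda>y. u y - w k y, \<lambda>y. cov_deriv a u y - h k y) + 2 * H1_normsq 1 (\<lambda>y. w k y - v y, \<lambda>y. h k y - g y)"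
    using assms(2,3) H1_L2[OF assms(4)[of k]] C1c_L2[OF u]
    by (intro H1_normsq_add_le L2_diff) auto
  also have "\<dots> < e" using k lt by simp
  finally show "\<exists>u\<in>C1c. H1_normsq 1 (\<lambda>y. u y - v y, \<lambda>y. cov_deriv a u y - g y) < e"
    using u by auto
qed

text \<open>The map on pairs in the conclusion is bounded on L^2 and carries \<open>u\<close> and
  its derivative for \<open>a\<close> to \<open>\<eta> u\<close> and its derivative for
  \<open>a + b\<close>; hence it carries closure into closure. Cutoff and change of potential are
  combined because \<open>potvec b\<close> is unbounded and only its product with a decaying
  \<open>\<eta>\<close> acts boundedly.\<close>

lemma H1_mult:
  fixes a b :: "'n::finite potential"
  assumes "V > 0" "V' > 0" "(v, g) \<in> H1 V a" "has_grad \<eta> E"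
    and "\<And>y. norm (\<eta> y) \<le> K" "\<And>y. norm (E y) \<le> K" "\<And>y. norm (\<eta> y *s potvec b y) \<le> K"
  shows "(\<lambda>y. \<eta> y * v y, \<lambda>y. \<eta> y *s g y + v y *s E y + (\<eta> y * v y) *s potvec b y) \<in> H1 V' (a + b)"
proof -
  note [measurable] = has_grad_measurable[OF assms(4)]
  have mL2: "(\<lambda>y. \<eta> y * w y) \<in> L2" "(\<lambda>y. \<eta> y *s h y + w y *s E y + (\<eta> y * w y) *s potvec b y) \<in> L2"
    if "w \<in> L2" "h \<in> L2" for w and h :: "real^'n \<Rightarrow> complex^'n"
  proof -
    show "(\<lambda>y. \<eta> y * w y) \<in> L2" using that(1) _ assms(5) by (rule L2_mult) simp
    have "(\<lambda>y. w y *s (\<eta> y *s potvec b y)) \<in> L2"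
      using that(1) _ assms(7) by (rule L2_smult_vec) simp
    then have "(\<lambda>y. (\<eta> y * w y) *s potvec b y) \<in> L2"
      by (simp add: vector_smult_assoc mult.commute)
    then show "(\<lambda>y. \<eta> y *s h y + w y *s E y + (\<eta> y * w y) *s potvec b y) \<in> L2"
      using that assms(5,6)
      by (intro L2_add L2_smult[OF that(2), where K = K] L2_smult_vec[OF that(1), where K = K]) auto
  qed
  note vg = H1_L2[OF assms(3)]
  have "K \<ge> 0" using assms(5)[of 0] norm_ge_zero order_trans by blast
  show ?thesis
    unfolding H1_iff[OF assms(2)]
  proof (intro conjI allI impI vg mL2(1)[OF vg] mL2(2)[OF vg])
    fix e :: real assume "e > 0"
    \<comment> \<open>The estimate \<open>pt\<close> costs 2 K^2 on \<open>h\<close> and 8 K^2 + K^2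
      on \<open>w\<close>; 9 K^2 covers both, and the summand 1 keeps \<open>M\<close> positive when
      \<open>K = 0\<close>.\<close>
    define M where "M = 9 * K\<^sup>2 + 1"
    have "M > 0" unfolding M_def by (simp add: add_nonneg_pos)
    then have "e / M > 0" using \<open>e > 0\<close> by simp
    then obtain u where u: "u \<in> C1c"
      and lt: "H1_normsq 1 (\<lambda>y. u y - v y, \<lambda>y. cov_deriv a u y - g y) < e / M"
      using assms(3) unfolding H1_iff[OF assms(1)] by blast
    define w where "w = (\<lambda>y. u y - v y)"
    define h where "h = (\<lambda>y. cov_deriv a u y - g y)"
    have wh: "w \<in> L2" "h \<in> L2"
      unfolding w_def h_def using vg C1c_L2[OF u] by (auto intro: L2_diff)
    let ?W = "\<lambda>y. \<eta> y * w y" and ?H = "\<lambda>y. \<eta> y *s h y + w y *s E y + (\<eta> y * w y) *s potvec b y"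
    have pt: "(norm (?H y))\<^sup>2 + 1 * (norm (?W y))\<^sup>2 \<le> M * ((norm (h y))\<^sup>2 + 1 * (norm (w y))\<^sup>2)" for y
    proof -
      have 1: "norm (\<eta> y *s h y) \<le> K * norm (h y)"
        using assms(5) by (auto simp: norm_smult intro!: mult_right_mono)
      have 2: "norm (w y *s E y) \<le> K * norm (w y)"
        using assms(6) by (auto simp: norm_smult mult.commute[of K] intro!: mult_left_mono)
      have "norm ((\<eta> y * w y) *s potvec b y) = norm (w y) * norm (\<eta> y *s potvec b y)"
        by (simp add: norm_smult norm_mult)
      then have 3: "norm ((\<eta> y * w y) *s potvec b y) \<le> K * norm (w y)"
        using assms(7) by (auto simp: mult.commute[of K] intro!: mult_left_mono)
      have 4: "norm (?W y) \<le> K * norm (w y)"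
        using assms(5) by (auto simp: norm_mult intro!: mult_right_mono)
      have "norm (?H y) \<le> K * (norm (h y) + 2 * norm (w y))"
        using norm_triangle_ineq[of "\<eta> y *s h y + w y *s E y" "(\<eta> y * w y) *s potvec b y"]
          norm_triangle_ineq[of "\<eta> y *s h y" "w y *s E y"] 1 2 3 by (simp add: algebra_simps)
      then have "(norm (?H y))\<^sup>2 \<le> (K * (norm (h y) + 2 * norm (w y)))\<^sup>2"
        by (intro power_mono) auto
      also have "\<dots> = K\<^sup>2 * (norm (h y) + 2 * norm (w y))\<^sup>2"
        by (simp add: power_mult_distrib)
      also have "\<dots> \<le> K\<^sup>2 * (2 * (norm (h y))\<^sup>2 + 8 * (norm (w y))\<^sup>2)"
        using sum_squares_bound[of "norm (h y)" "2 * norm (w y)"]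
        by (intro mult_left_mono) (auto simp: power2_sum power_mult_distrib)
      finally have A: "(norm (?H y))\<^sup>2 \<le> K\<^sup>2 * (2 * (norm (h y))\<^sup>2 + 8 * (norm (w y))\<^sup>2)" .
      have B: "(norm (?W y))\<^sup>2 \<le> K\<^sup>2 * (norm (w y))\<^sup>2"
        using power_mono[OF 4, of 2] by (simp add: power_mult_distrib)
      have "(norm (?H y))\<^sup>2 + (norm (?W y))\<^sup>2 \<le> K\<^sup>2 * (2 * (norm (h y))\<^sup>2 + 9 * (norm (w y))\<^sup>2)"
        using A B by (simp add: algebra_simps)
      also have "\<dots> \<le> K\<^sup>2 * (9 * (norm (h y))\<^sup>2 + 9 * (norm (w y))\<^sup>2)"
        by (intro mult_left_mono) auto
      also have "\<dots> \<le> M * ((norm (h y))\<^sup>2 + (norm (w y))\<^sup>2)"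
        by (simp add: M_def algebra_simps)
      finally show ?thesis by simp
    qed
    have "H1_normsq 1 (?W, ?H) \<le> (\<integral>y. M * ((norm (h y))\<^sup>2 + 1 * (norm (w y))\<^sup>2) \<partial>lborel)"
      unfolding H1_normsq_def prod.case
      using L2_integrable[OF mL2(1)[OF wh]] L2_integrable[OF mL2(2)[OF wh]] wh[THEN L2_integrable] pt
      by (intro integral_mono) auto
    also have "\<dots> = M * H1_normsq 1 (w, h)"
      by (simp add: H1_normsq_def)
    also have "\<dots> < e" using lt \<open>M > 0\<close> by (simp add: w_def h_def field_simps)
    finally have less: "H1_normsq 1 (?W, ?H) < e" .
    have "(\<lambda>y. \<eta> y * u y - \<eta> y * v y) = ?W"
      by (simp add: w_def algebra_simps)
    moreover have "(\<lambda>y. cov_deriv (a + b) (\<lambda>y. \<eta> y * u y) y - (\<eta> y *s g y + v y *s E y + (\<eta> y * v y) *s potvec b y)) = ?H"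
      by (simp add: C1c_mult(2)[OF u assms(4)] w_def h_def vec_eq_iff fun_eq_iff algebra_simps)
    ultimately show "\<exists>f\<in>C1c. H1_normsq 1 (\<lambda>y. f y - \<eta> y * v y, \<lambda>y. cov_deriv (a + b) f y - (\<eta> y *s g y + v y *s E y + (\<eta> y * v y) *s potvec b y)) < e"
      using less C1c_mult(1)[OF u assms(4)] by (intro bexI[of _ "\<lambda>y. \<eta> y * u y"]) auto
  qed
qed

lemma H1_mult_same:
  fixes a :: "'n::finite potential"
  assumes "V > 0" "(v, g) \<in> H1 V a" "has_grad \<eta> E"
    and "\<And>y. norm (\<eta> y) \<le> K" "\<And>y. norm (E y) \<le> K"
  shows "(\<lambda>y. \<eta> y * v y, \<lambda>y. \<eta> y *s g y + v y *s E y) \<in> H1 V a"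
proof -
  have "K \<ge> 0" using assms(4)[of 0] norm_ge_zero order_trans by blast
  then show ?thesis
    using H1_mult[OF assms(1,1,2,3,4,5), of 0] by simp
qed

lemma H1_scaleR:
  assumes "V > 0" "(v, g) \<in> H1 V a"
  shows "(\<lambda>y. t *\<^sub>R v y, \<lambda>y. t *\<^sub>R g y) \<in> H1 V a"
  using H1_mult_same[OF assms has_grad_const, of "complex_of_real t" "\<bar>t\<bar>"]
  by (simp add: scaleR_conv_of_real scaleR_vec_def vector_scalar_mult_def plus_vec_def)

lemma H1_normsq_scaleR: "H1_normsq V (\<lambda>y. t *\<^sub>R v y, \<lambda>y. t *\<^sub>R g y) = t\<^sup>2 * H1_normsq V (v, g)"
  by (simp add: H1_normsq_def power_mult_distrib flip: integral_mult_right_zero)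
     (simp add: algebra_simps)

section \<open>The Nehari manifold\<close>

definition lp_int :: "real \<Rightarrow> (real^'n::finite \<Rightarrow> complex) \<Rightarrow> real" where
  "lp_int p v = (\<integral>y. norm (v y) powr p \<partial>lborel)"

lemma lp_int_nonneg: "lp_int p v \<ge> 0"
  by (simp add: lp_int_def)

lemma lp_int_scaleR: "lp_int p (\<lambda>y. t *\<^sub>R v y) = \<bar>t\<bar> powr p * lp_int p v"
  by (simp add: lp_int_def powr_mult)

lemma action_eq: "action p V (v, g) = 1 / 2 * H1_normsq V (v, g) - 1 / p * lp_int p v"
  by (simp add: action_def H1_normsq_def lp_int_def)

text \<open>By homogeneity the functional along the ray through \<open>v\<close> is an explicit
  function of \<open>t\<close>, so nothing is differentiated under the integral.\<close>

lemma action_deriv_self: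
  assumes "p > 0"
  shows "action_deriv p V (v, g) (v, g) = H1_normsq V (v, g) - lp_int p v"
proof -
  let ?N = "H1_normsq V (v, g)" and ?P = "lp_int p v"
  have eq: "action p V (\<lambda>y. v y + t *\<^sub>R v y, \<lambda>y. g y + t *\<^sub>R g y)
      = 1 / 2 * ((1 + t)\<^sup>2 * ?N) - 1 / p * (\<bar>1 + t\<bar> powr p * ?P)" for t
    using H1_normsq_scaleR[of V "1 + t" v g] lp_int_scaleR[of p "1 + t" v]
    by (simp add: action_eq scaleR_add_left)
  have "((\<lambda>t. 1 / 2 * ((1 + t)\<^sup>2 * ?N) - 1 / p * ((1 + t) powr p * ?P)) has_real_derivative ?N - ?P) (at 0)"
    using assms by (auto intro!: derivative_eq_intros simp: field_simps)
  moreover have "\<forall>\<^sub>F t in nhds 0. 1 / 2 * ((1 + t)\<^sup>2 * ?N) - 1 / p * ((1 + t) powr p * ?P)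
      = 1 / 2 * ((1 + t)\<^sup>2 * ?N) - 1 / p * (\<bar>1 + t\<bar> powr p * ?P)"
  proof (rule eventually_mono)
    show "\<forall>\<^sub>F t in nhds 0. (t::real) \<in> {-1<..}"
      by (rule eventually_nhds_in_open) auto
  qed auto
  ultimately have "((\<lambda>t. 1 / 2 * ((1 + t)\<^sup>2 * ?N) - 1 / p * (\<bar>1 + t\<bar> powr p * ?P)) has_real_derivative ?N - ?P) (at 0)"
    by (subst (asm) DERIV_cong_ev[OF refl _ refl])
  then show ?thesis
    by (simp add: action_deriv_def eq DERIV_imp_deriv)
qed

text \<open>No integrability of \<open>|v|\<^sup>p\<close> is needed here: if it fails, the junk value
  \<open>lp_int p v = 0\<close> scales in the same way, and the right-hand side cannot hold.\<close>

lemma nehari_iff: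
  "p > 0 \<Longrightarrow> (v, g) \<in> nehari p V a \<longleftrightarrow>
     (v, g) \<in> H1 V a \<and> \<not> (AE y in lborel. v y = 0) \<and> H1_normsq V (v, g) = lp_int p v"
  by (simp add: nehari_def action_deriv_self)

lemma H1_normsq_pos:
  assumes "V > 0" "(v, g) \<in> H1 V a" "\<not> (AE y in lborel. v y = 0)"
  shows "H1_normsq V (v, g) > 0"
proof -
  have L2: "v \<in> L2" "g \<in> L2" using H1_L2[OF assms(2)] by auto
  have "(\<integral>y. (norm (v y))\<^sup>2 \<partial>lborel) \<noteq> 0"
    using integral_nonneg_eq_0_iff_AE[OF L2_integrable[OF L2(1)]] assms(3) by auto
  moreover have "(\<integral>y. (norm (v y))\<^sup>2 \<partial>lborel) \<ge> 0"
    by simp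
  ultimately have "V * (\<integral>y. (norm (v y))\<^sup>2 \<partial>lborel) > 0"
    using assms(1) by (metis mult_pos_pos order_le_less)
  then show ?thesis
    by (simp add: H1_normsq_eq[OF L2] add_nonneg_pos)
qed

lemma lp_int_eq_0: "(AE y in lborel. v y = 0) \<Longrightarrow> lp_int p v = 0"
  unfolding lp_int_def by (rule integral_eq_zero_AE) auto

text \<open>Scaling \<open>w\<close> onto the Nehari manifold turns a lower bound of the ground-energy into a Sobolev
  inequality; for the ground-state itself it is an equality.\<close>

lemma sobolev_of_ground_energy:
  assumes "p > 2" "V > 0" "(w, h) \<in> H1 V a" "N > 0"
    and "(1 / 2 - 1 / p) * N \<le> ground_energy p V a"
  shows "lp_int p w / N \<le> (H1_normsq V (w, h) / N) powr (p / 2)"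
proof (cases "lp_int p w = 0")
  case True
  then show ?thesis by simp
next
  case False
  define P where "P = lp_int p w"
  define n where "n = H1_normsq V (w, h)"
  \<comment> \<open>The factor for which \<open>t w\<close> satisfies the Nehari identity; see
    \<open>tp\<close>.\<close>
  define t where "t = (n / P) powr (1 / (p - 2))"
  define s where "s = n / N"
  have "P > 0" using False lp_int_nonneg[of p w] by (simp add: P_def)
  have nz: "\<not> (AE y in lborel. w y = 0)" using False lp_int_eq_0 by blast
  have "n > 0" unfolding n_def using assms(2,3) nz by (rule H1_normsq_pos)
  have "t > 0" unfolding t_def using \<open>n > 0\<close> \<open>P > 0\<close> by simp
  have "s > 0" using \<open>n > 0\<close> \<open>N > 0\<close> by (simp add: s_def)
  have tp2: "t powr (p - 2) = n / P"
    using \<open>n > 0\<close> \<open>P > 0\<close> \<open>p > 2\<close> by (simp add: t_def powr_powr)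
  have tp: "t powr p * P = t\<^sup>2 * n"
  proof -
    have "t powr p = t powr (p - 2) * t powr 2"
      by (simp flip: powr_add)
    also have "\<dots> = n / P * t\<^sup>2"
      using \<open>t > 0\<close> by (simp only: tp2 powr_numeral)
    finally show ?thesis using \<open>P > 0\<close> by simp
  qed
  let ?tw = "(\<lambda>y. t *\<^sub>R w y, \<lambda>y. t *\<^sub>R h y)"
  have "?tw \<in> nehari p V a"
    using \<open>p > 2\<close> H1_scaleR[OF assms(2,3)] nz tp \<open>t > 0\<close>
    by (simp add: nehari_iff H1_normsq_scaleR lp_int_scaleR flip: n_def P_def)
  \<comment> \<open>On the reals, \<open>Inf\<close> bounds only those sets from below that are
    bounded below. On the Nehari manifold the action is a nonnegative multiple of the squared
    norm.\<close>
  moreover have "bdd_below (action p V ` nehari p V a)"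
  proof (rule bdd_belowI2)
    fix z assume z: "z \<in> nehari p V a"
    obtain f k where fk: "z = (f, k)" by force
    then have "action p V z = (1 / 2 - 1 / p) * H1_normsq V z"
      using z \<open>p > 2\<close> by (simp add: nehari_iff action_eq algebra_simps)
    also have "\<dots> \<ge> 0"
      using \<open>p > 2\<close> H1_normsq_nonneg[OF assms(2), of z] by (intro mult_nonneg_nonneg) (auto simp: field_simps)
    finally show "0 \<le> action p V z" .
  qed
  ultimately have "ground_energy p V a \<le> action p V ?tw"
    unfolding ground_energy_def by (intro cInf_lower imageI)
  also have "\<dots> = (1 / 2 - 1 / p) * (t\<^sup>2 * n)"
    using tp \<open>t > 0\<close> by (simp add: action_eq H1_normsq_scaleR lp_int_scaleR algebra_simps flip: n_def P_def)
  finally have "(1 / 2 - 1 / p) * N \<le> (1 / 2 - 1 / p) * (t\<^sup>2 * n)"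
    using assms(5) by simp
  moreover have "1 / 2 - 1 / p > 0" using \<open>p > 2\<close> by (simp add: field_simps)
  ultimately have "N \<le> t\<^sup>2 * n" by simp
  then have "1 \<le> t\<^sup>2 * s" using \<open>N > 0\<close> by (simp add: s_def field_simps)
  \<comment> \<open>With this exponent the power of \<open>t\<close> becomes
    \<open>t powr (p - 2)\<close>, which equals \<open>n / P\<close>, and \<open>t\<close>
    disappears.\<close>
  then have "1 powr ((p - 2) / 2) \<le> (t powr 2 * s) powr ((p - 2) / 2)"
    using \<open>p > 2\<close> \<open>t > 0\<close> by (intro powr_mono2) auto
  also have "\<dots> = n / P * s powr (p / 2 - 1)"
    using \<open>t > 0\<close> \<open>s > 0\<close> by (simp add: powr_mult powr_powr tp2 diff_divide_distrib del: powr_numeral)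
  finally have "P \<le> n * s powr (p / 2 - 1)"
    using \<open>P > 0\<close> by (simp add: field_simps)
  then have "P / N \<le> s * s powr (p / 2 - 1)"
    using \<open>N > 0\<close> by (simp add: s_def field_simps)
  also have "\<dots> = s powr (p / 2)"
    using \<open>s > 0\<close> powr_add[of s 1 "p / 2 - 1"] by simp
  finally show ?thesis by (simp add: P_def s_def n_def)
qed

section \<open>Rational cutoffs and change of the potential\<close>

definition cvec :: "real^'n::finite \<Rightarrow> complex^'n" where
  "cvec y = (\<chi> i. complex_of_real (y $ i))"

lemma norm_cvec [simp]: "norm (cvec y) = norm y"
  by (simp add: cvec_def norm_vec_def)

text \<open>A rational weight has a closed-form gradient. Its quadratic decay just suffices to bound
  its product with y_i y_j, while its product with y_i has a gradient bounded uniformly in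
  \<open>e\<close> for 0 < e \<le> 1.\<close>

definition cutoff :: "real \<Rightarrow> real^'n::finite \<Rightarrow> complex" where
  "cutoff e y = complex_of_real (inverse (1 + e * (norm y)\<^sup>2))"

definition grad_cutoff :: "real \<Rightarrow> real^'n::finite \<Rightarrow> complex^'n" where
  "grad_cutoff e y = complex_of_real (- 2 * e * (inverse (1 + e * (norm y)\<^sup>2))\<^sup>2) *s cvec y"

lemma has_grad_cutoff:
  assumes "e \<ge> 0"
  shows "has_grad (cutoff e :: real^'n::finite \<Rightarrow> complex) (grad_cutoff e)"
proof -
  have pos: "1 + e * (norm y)\<^sup>2 > 0" for y :: "real^'n"
    using assms by (simp add: add_pos_nonneg)
  have "has_grad (\<lambda>y::real^'n. inverse (1 + complex_of_real e * complex_of_real ((norm y)\<^sup>2)))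
     (\<lambda>y. - ((inverse (1 + complex_of_real e * complex_of_real ((norm y)\<^sup>2)))\<^sup>2 *s
        (0 + (complex_of_real e *s (2 *s (\<chi> i. complex_of_real (y $ i))) + complex_of_real ((norm y)\<^sup>2) *s 0))))"
  proof (intro has_grad_inverse has_grad_add has_grad_const has_grad_mult has_grad_normsq)
    fix y :: "real^'n"
    have "1 + complex_of_real e * complex_of_real ((norm y)\<^sup>2) = complex_of_real (1 + e * (norm y)\<^sup>2)"
      by simp
    then show "1 + complex_of_real e * complex_of_real ((norm y)\<^sup>2) \<noteq> 0"
      using pos[of y] by (simp only: of_real_eq_0_iff)
  qed
  moreover have c: "cutoff e = (\<lambda>y::real^'n. inverse (1 + complex_of_real e * complex_of_real ((norm y)\<^sup>2)))"
    by (simp add: cutoff_def fun_eq_iff)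
  moreover have "grad_cutoff e = (\<lambda>y::real^'n. - ((inverse (1 + complex_of_real e * complex_of_real ((norm y)\<^sup>2)))\<^sup>2 *s
        (0 + (complex_of_real e *s (2 *s (\<chi> i. complex_of_real (y $ i))) + complex_of_real ((norm y)\<^sup>2) *s 0))))"
    by (simp add: grad_cutoff_def cvec_def vec_eq_iff fun_eq_iff)
  ultimately show ?thesis by (simp only:)
qed

text \<open>The bounds free of \<open>e\<close> feed the uniform estimates and the dominated limits;
  those with \<open>1 / e\<close> only make weights with polynomial or potential factors admissible
  as multipliers.\<close>

lemma cutoff_bounds:
  fixes y :: "real^'n::finite"
  assumes "0 < e" "e \<le> 1"
  shows "norm (cutoff e y) \<le> 1" "norm (cutoff e y - 1) \<le> 1" "norm (grad_cutoff e y) \<le> 1"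
    "norm y * norm (grad_cutoff e y) \<le> 2" "norm y * norm (cutoff e y) \<le> 1 / e"
    "(norm y)\<^sup>2 * norm (cutoff e y) \<le> 1 / e" "(norm y)\<^sup>2 * norm (grad_cutoff e y) \<le> 1 / e"
proof -
  define r where "r = norm y"
  define d where "d = 1 + e * r\<^sup>2"
  have "r \<ge> 0" by (simp add: r_def)
  have "e * r\<^sup>2 \<ge> 0" using assms by simp
  then have "d \<ge> 1" by (simp add: d_def)
  have q: "norm (cutoff e y) = 1 / d"
    using \<open>d \<ge> 1\<close> unfolding cutoff_def norm_of_real by (simp add: d_def r_def inverse_eq_divide)
  have g: "norm (grad_cutoff e y) = 2 * e * r / d\<^sup>2"
    using \<open>d \<ge> 1\<close> assms by (simp add: grad_cutoff_def norm_smult norm_mult d_def r_def abs_mult field_simps del: of_real_add of_real_mult of_real_inverse of_real_power of_real_divide)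
  \<comment> \<open>Here \<open>e \<le> 1\<close> enters: 2 e r \<le> e + e r^2 \<le> 1 + e
    r^2.\<close>
  have "2 * r \<le> 1 + r\<^sup>2" using sum_squares_bound[of 1 r] by simp
  then have "e * (2 * r) \<le> e * (1 + r\<^sup>2)" using assms by (intro mult_left_mono) auto
  then have er: "2 * e * r \<le> d" using assms by (simp add: d_def algebra_simps)
  have dd: "d \<le> d\<^sup>2" using \<open>d \<ge> 1\<close> by (simp add: power2_eq_square)
  show "norm (cutoff e y) \<le> 1" using \<open>d \<ge> 1\<close> by (simp add: q)
  have "cutoff e y - 1 = complex_of_real (1 / d - 1)"
    by (simp add: cutoff_def d_def r_def inverse_eq_divide)
  then have "norm (cutoff e y - 1) = \<bar>1 / d - 1\<bar>"
    by (simp only: norm_of_real)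
  then show "norm (cutoff e y - 1) \<le> 1"
    using \<open>d \<ge> 1\<close> by (simp add: abs_if field_simps)
  show "norm (grad_cutoff e y) \<le> 1"
    using er dd \<open>d \<ge> 1\<close> by (simp add: g field_simps)
  have "e * r\<^sup>2 \<le> d\<^sup>2" using dd by (simp add: d_def)
  then show "norm y * norm (grad_cutoff e y) \<le> 2"
    using \<open>d \<ge> 1\<close> by (simp add: g field_simps power2_eq_square flip: r_def)
  have "e * r \<le> d" using er assms \<open>r \<ge> 0\<close> mult_nonneg_nonneg[of e r] by linarith
  then show "norm y * norm (cutoff e y) \<le> 1 / e"
    using \<open>d \<ge> 1\<close> assms by (simp add: q field_simps flip: r_def)
  have er2: "e * r\<^sup>2 \<le> d" by (simp add: d_def)
  then show "(norm y)\<^sup>2 * norm (cutoff e y) \<le> 1 / e"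
    using \<open>d \<ge> 1\<close> assms by (simp add: q field_simps flip: r_def)
  have "(e * r\<^sup>2) * (2 * e * r) \<le> d * d"
    using er er2 assms \<open>r \<ge> 0\<close> \<open>d \<ge> 1\<close> by (intro mult_mono) auto
  then show "(norm y)\<^sup>2 * norm (grad_cutoff e y) \<le> 1 / e"
    using \<open>d \<ge> 1\<close> assms \<open>r \<ge> 0\<close> by (simp add: g field_simps power2_eq_square flip: r_def)
qed

lemma cutoff_tendsto:
  fixes y :: "real^'n::finite"
  shows "(\<lambda>k. cutoff (1 / real (Suc k)) y) \<longlonglongrightarrow> 1" "(\<lambda>k. grad_cutoff (1 / real (Suc k)) y) \<longlonglongrightarrow> 0"
proof -
  have e: "(\<lambda>k. 1 / real (Suc k)) \<longlonglongrightarrow> 0" by (rule lim_1_over_n[THEN LIMSEQ_Suc])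
  have "(\<lambda>k. inverse (1 + 1 / real (Suc k) * (norm y)\<^sup>2)) \<longlonglongrightarrow> inverse (1 + 0 * (norm y)\<^sup>2)"
    by (intro tendsto_intros e) simp
  then have q: "(\<lambda>k. inverse (1 + 1 / real (Suc k) * (norm y)\<^sup>2)) \<longlonglongrightarrow> 1" by simp
  show "(\<lambda>k. cutoff (1 / real (Suc k)) y) \<longlonglongrightarrow> 1"
    unfolding cutoff_def using tendsto_of_real[OF q, where 'a = complex] by simp
  have "(\<lambda>k. complex_of_real (- 2 * (1 / real (Suc k)) * (inverse (1 + 1 / real (Suc k) * (norm y)\<^sup>2))\<^sup>2) *s cvec y)
      \<longlonglongrightarrow> complex_of_real (- 2 * 0 * 1\<^sup>2) *s cvec y"
    by (intro bounded_bilinear.tendsto[OF bounded_bilinear_smult] tendsto_intros e q)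
  then show "(\<lambda>k. grad_cutoff (1 / real (Suc k)) y) \<longlonglongrightarrow> 0"
    by (simp add: grad_cutoff_def)
qed

lemma H1_normsq_dominated:
  fixes w :: "nat \<Rightarrow> real^'n::finite \<Rightarrow> complex" and h :: "nat \<Rightarrow> real^'n \<Rightarrow> complex^'n"
  assumes "\<And>k. w k \<in> borel_measurable borel" "\<And>k. h k \<in> borel_measurable borel" "integrable lborel D"
    and "\<And>k y. (norm (h k y))\<^sup>2 + (norm (w k y))\<^sup>2 \<le> D y"
    and "\<And>y. (\<lambda>k. w k y) \<longlonglongrightarrow> 0" "\<And>y. (\<lambda>k. h k y) \<longlonglongrightarrow> 0"
  shows "(\<lambda>k. H1_normsq 1 (w k, h k)) \<longlonglongrightarrow> 0"
proof -
  have lim: "(\<lambda>k. (norm (h k y))\<^sup>2 + 1 * (norm (w k y))\<^sup>2) \<longlonglongrightarrow> 0" for y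
  proof -
    have "(\<lambda>k. (norm (h k y))\<^sup>2 + 1 * (norm (w k y))\<^sup>2) \<longlonglongrightarrow> (norm (0 :: complex^'n))\<^sup>2 + 1 * (norm (0 :: complex))\<^sup>2"
      by (intro tendsto_intros assms)
    then show ?thesis by simp
  qed
  have "(\<lambda>k. \<integral>y. (norm (h k y))\<^sup>2 + 1 * (norm (w k y))\<^sup>2 \<partial>lborel) \<longlonglongrightarrow> (\<integral>y. 0 \<partial>(lborel :: (real^'n) measure))"
    by (rule integral_dominated_convergence[where w = D]) (use assms(1-4) lim in auto)
  then show ?thesis by (simp add: H1_normsq_def)
qed

text \<open>The decay of \<open>v\<close> makes the new covariant derivative square integrable. That
  the pair lies in the closure is seen by multiplying with a cutoff, changing the potential by
  \<open>H1_mult\<close>, and removing the cutoff by dominated convergence.\<close>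

lemma H1_change_potential:
  fixes a b :: "'n::finite potential"
  assumes "V > 0" "V' > 0" "(v, g) \<in> H1 V a" "(\<lambda>y. norm y *\<^sub>R v y) \<in> L2"
  shows "(v, \<lambda>y. g y + v y *s potvec b y) \<in> H1 V' (a + b)"
proof -
  define \<epsilon> where "\<epsilon> k = 1 / real (Suc k)" for k
  have \<epsilon>: "0 < \<epsilon> k" "\<epsilon> k \<le> 1" for k by (auto simp: \<epsilon>_def)
  note vg = H1_L2[OF assms(3)]
  note [measurable] = vg[THEN L2_measurable] has_grad_measurable[OF has_grad_cutoff[OF less_imp_le[OF \<epsilon>(1)]]]
  define G where "G = (\<lambda>y. g y + v y *s potvec b y)"
  have "(\<lambda>y. v y *s potvec b y) \<in> L2"
  proof (rule L2_dominated[OF assms(4)])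
    fix y
    have "norm (v y) * norm (potvec b y) \<le> norm (v y) * (real CARD('n) * norm b * norm y)"
      by (intro mult_left_mono norm_potvec_le) auto
    then show "norm (v y *s potvec b y) \<le> (real CARD('n) * norm b) * norm (norm y *\<^sub>R v y)"
      by (simp add: norm_smult mult_ac)
  qed simp
  then have G: "G \<in> L2" unfolding G_def using vg by (intro L2_add)
  note [measurable] = L2_measurable[OF G]
  let ?w = "\<lambda>k y. cutoff (\<epsilon> k) y * v y"
  let ?h = "\<lambda>k y. cutoff (\<epsilon> k) y *s g y + v y *s grad_cutoff (\<epsilon> k) y + (cutoff (\<epsilon> k) y * v y) *s potvec b y"
  have mem: "(?w k, ?h k) \<in> H1 V' (a + b)" for k
  proof -
    have "norm (cutoff (\<epsilon> k) y *s potvec b y) \<le> real CARD('n) * norm b * (1 / \<epsilon> k)" for y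
    proof -
      have "norm (cutoff (\<epsilon> k) y) * norm (potvec b y) \<le> norm (cutoff (\<epsilon> k) y) * (real CARD('n) * norm b * norm y)"
        by (intro mult_left_mono norm_potvec_le) auto
      also have "\<dots> = real CARD('n) * norm b * (norm y * norm (cutoff (\<epsilon> k) y))"
        by (simp add: mult_ac)
      also have "\<dots> \<le> real CARD('n) * norm b * (1 / \<epsilon> k)"
        by (intro mult_left_mono cutoff_bounds \<epsilon>) auto
      finally show ?thesis by (simp add: norm_smult)
    qed
    then show ?thesis
      using cutoff_bounds[OF \<epsilon>]
      by (intro H1_mult[OF assms(1-3) has_grad_cutoff, where K = "max 1 (real CARD('n) * norm b * (1 / \<epsilon> k))"])
         (auto simp: le_max_iff_disj less_imp_le[OF \<epsilon>(1)])
  qed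
  \<comment> \<open>Collecting the terms with \<open>g\<close> and with \<open>potvec b\<close> into
    a multiple of \<open>G\<close> hides the unbounded factor inside a square integrable function
    that can dominate.\<close>
  have diff: "?w k y - v y = (cutoff (\<epsilon> k) y - 1) * v y"
    "?h k y - G y = (cutoff (\<epsilon> k) y - 1) *s G y + v y *s grad_cutoff (\<epsilon> k) y" for k y
    by (simp_all add: G_def vec_eq_iff algebra_simps)
  have "(\<lambda>k. H1_normsq 1 (\<lambda>y. ?w k y - v y, \<lambda>y. ?h k y - G y)) \<longlonglongrightarrow> 0"
    unfolding diff
  proof (rule H1_normsq_dominated)
    show "integrable lborel (\<lambda>y. 2 * (norm (G y))\<^sup>2 + 3 * (norm (v y))\<^sup>2)"
      using L2_integrable[OF G] L2_integrable[OF vg(1)] by simp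
    show "(norm ((cutoff (\<epsilon> k) y - 1) *s G y + v y *s grad_cutoff (\<epsilon> k) y))\<^sup>2 + (norm ((cutoff (\<epsilon> k) y - 1) * v y))\<^sup>2
       \<le> 2 * (norm (G y))\<^sup>2 + 3 * (norm (v y))\<^sup>2" for k y
    proof -
      have "norm ((cutoff (\<epsilon> k) y - 1) *s G y) \<le> norm (G y)" "norm (v y *s grad_cutoff (\<epsilon> k) y) \<le> norm (v y)"
        "norm ((cutoff (\<epsilon> k) y - 1) * v y) \<le> norm (v y)"
        using cutoff_bounds[OF \<epsilon>(1)[of k] \<epsilon>(2)[of k], of y] by (auto simp: norm_smult norm_mult simp del: vector_ssub_ldistrib vector_sub_rdistrib intro: mult_left_le mult_left_le_one_le)
      then have "(norm ((cutoff (\<epsilon> k) y - 1) *s G y))\<^sup>2 \<le> (norm (G y))\<^sup>2" "(norm (v y *s grad_cutoff (\<epsilon> k) y))\<^sup>2 \<le> (norm (v y))\<^sup>2"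
        "(norm ((cutoff (\<epsilon> k) y - 1) * v y))\<^sup>2 \<le> (norm (v y))\<^sup>2"
        by (auto intro!: power_mono)
      then show ?thesis
        using norm_add_sq_le[of "(cutoff (\<epsilon> k) y - 1) *s G y" "v y *s grad_cutoff (\<epsilon> k) y"] by linarith
    qed
    fix y :: "real^'n"
    have c: "(\<lambda>k. cutoff (\<epsilon> k) y - 1) \<longlonglongrightarrow> 0" "(\<lambda>k. grad_cutoff (\<epsilon> k) y) \<longlonglongrightarrow> 0"
      using cutoff_tendsto[of y] unfolding \<epsilon>_def by (auto simp: LIM_zero)
    show "(\<lambda>k. (cutoff (\<epsilon> k) y - 1) * v y) \<longlonglongrightarrow> 0"
      using c(1) by (rule tendsto_mult_left_zero)
    have "(\<lambda>k. (cutoff (\<epsilon> k) y - 1) *s G y + v y *s grad_cutoff (\<epsilon> k) y) \<longlonglongrightarrow> 0 *s G y + v y *s 0"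
      by (intro tendsto_add bounded_bilinear.tendsto[OF bounded_bilinear_smult] c tendsto_const)
    then show "(\<lambda>k. (cutoff (\<epsilon> k) y - 1) *s G y + v y *s grad_cutoff (\<epsilon> k) y) \<longlonglongrightarrow> 0"
      by simp
  qed measurable
  then show ?thesis
    using H1_closed[OF assms(2) vg(1) G mem] by (simp add: G_def)
qed

section \<open>Inequalities for the variational arguments\<close>

lemma Holder_integral:
  fixes f g :: "'a \<Rightarrow> real"
  assumes "integrable M f" "integrable M g" "\<And>x. f x \<ge> 0" "\<And>x. g x \<ge> 0" "0 < \<alpha>" "\<alpha> < 1"
  shows "(\<integral>x. f x powr \<alpha> * g x powr (1 - \<alpha>) \<partial>M) \<le> (\<integral>x. f x \<partial>M) powr \<alpha> * (\<integral>x. g x \<partial>M) powr (1 - \<alpha>)"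
proof -
  define F where "F = (\<integral>x. f x \<partial>M)"
  define G where "G = (\<integral>x. g x \<partial>M)"
  have "F \<ge> 0" "G \<ge> 0" using assms by (simp_all add: F_def G_def)
  consider "F = 0" | "G = 0" | "F > 0" "G > 0"
    using \<open>F \<ge> 0\<close> \<open>G \<ge> 0\<close> by linarith
  then show ?thesis
  proof cases
    case 1
    then have "AE x in M. f x = 0"
      using integral_nonneg_eq_0_iff_AE[OF assms(1)] assms(3) by (simp add: F_def)
    then have "(\<integral>x. f x powr \<alpha> * g x powr (1 - \<alpha>) \<partial>M) = 0"
      by (intro integral_eq_zero_AE) auto
    then show ?thesis by simp
  next
    case 2
    then have "AE x in M. g x = 0"
      using integral_nonneg_eq_0_iff_AE[OF assms(2)] assms(4) by (simp add: G_def)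
    then have "(\<integral>x. f x powr \<alpha> * g x powr (1 - \<alpha>) \<partial>M) = 0"
      by (intro integral_eq_zero_AE) auto
    then show ?thesis by simp
  next
    case 3
    define c where "c = F powr \<alpha> * G powr (1 - \<alpha>)"
    have "c > 0" using 3 by (simp add: c_def)
    have pt: "f x powr \<alpha> * g x powr (1 - \<alpha>) \<le> c * (\<alpha> * (f x / F) + (1 - \<alpha>) * (g x / G))" for x
    proof (cases "f x = 0 \<or> g x = 0")
      case True
      have "0 \<le> c * (\<alpha> * (f x / F) + (1 - \<alpha>) * (g x / G))"
        using 3 assms \<open>c > 0\<close> by (intro mult_nonneg_nonneg add_nonneg_nonneg) auto
      then show ?thesis using True by auto
    next
      case False
      then have pos: "f x > 0" "g x > 0" using assms(3,4)[of x] by auto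
      have "(f x / F) powr \<alpha> * (g x / G) powr (1 - \<alpha>) \<le> \<alpha> * (f x / F) + (1 - \<alpha>) * (g x / G)"
        using pos 3 assms(5,6) by (intro Youngs_inequality_0) auto
      then have "c * ((f x / F) powr \<alpha> * (g x / G) powr (1 - \<alpha>)) \<le> c * (\<alpha> * (f x / F) + (1 - \<alpha>) * (g x / G))"
        using \<open>c > 0\<close> by (intro mult_left_mono) auto
      moreover have "c * ((f x / F) powr \<alpha> * (g x / G) powr (1 - \<alpha>)) = f x powr \<alpha> * g x powr (1 - \<alpha>)"
        using 3 pos by (simp add: c_def powr_divide)
      ultimately show ?thesis by simp
    qed
    have int: "integrable M (\<lambda>x. c * (\<alpha> * (f x / F) + (1 - \<alpha>) * (g x / G)))"
      using assms(1,2) by simp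
    have "(\<integral>x. f x powr \<alpha> * g x powr (1 - \<alpha>) \<partial>M) \<le> (\<integral>x. c * (\<alpha> * (f x / F) + (1 - \<alpha>) * (g x / G)) \<partial>M)"
    proof (rule integral_mono[OF _ int pt])
      show "integrable M (\<lambda>x. f x powr \<alpha> * g x powr (1 - \<alpha>))"
        by (rule Bochner_Integration.integrable_bound[OF int])
           (use assms(1,2) order_trans[OF pt abs_ge_self] in auto)
    qed
    also have "\<dots> = c * (\<alpha> * (F / F) + (1 - \<alpha>) * (G / G))"
      using assms(1,2) by (simp add: F_def G_def)
    also have "\<dots> = c" using 3 by simp
    finally show ?thesis by (simp add: c_def F_def G_def)
  qed
qed

text \<open>Bernoulli's inequality for a real exponent, from Young's inequality for
  \<open>(1 - s) powr p\<close> and 1.\<close>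

lemma powr_one_minus_ge:
  fixes s p :: real
  assumes "p \<ge> 1" "s < 1"
  shows "(1 - s) powr p \<ge> 1 - p * s"
proof -
  have "((1 - s) powr p) powr (1 / p) * 1 powr (1 - 1 / p) \<le> 1 / p * (1 - s) powr p + (1 - 1 / p) * 1"
    using assms by (intro Youngs_inequality_0) auto
  then have "1 - s \<le> 1 / p * (1 - s) powr p + (1 - 1 / p)"
    using assms by (simp add: powr_powr)
  then have "p * (1 - s) \<le> p * (1 / p * (1 - s) powr p + (1 - 1 / p))"
    using assms by (intro mult_left_mono) auto
  also have "\<dots> = (1 - s) powr p + (p - 1)"
    using assms by (simp add: algebra_simps)
  finally show ?thesis by (simp add: algebra_simps)
qed

lemma quadratic_nonneg_imp_zero:
  fixes \<beta> \<gamma> :: real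
  assumes "\<And>t. 0 \<le> 2 * t * \<beta> + t\<^sup>2 * \<gamma>" "\<gamma> \<ge> 0"
  shows "\<beta> = 0"
proof (rule ccontr)
  assume "\<beta> \<noteq> 0"
  \<comment> \<open>The vertex of the parabola is at \<open>- \<beta> / \<gamma>\<close>; adding 1
    keeps the quotient meaningful for \<open>\<gamma> = 0\<close>, and the value is still
    negative.\<close>
  have "2 * (- \<beta> / (\<gamma> + 1)) * \<beta> + (- \<beta> / (\<gamma> + 1))\<^sup>2 * \<gamma> = - (\<beta>\<^sup>2 * (\<gamma> + 2)) / (\<gamma> + 1)\<^sup>2"
    using \<open>\<gamma> \<ge> 0\<close> by (simp add: divide_simps) (simp add: power2_eq_square algebra_simps)
  moreover have "\<dots> < 0"
    using \<open>\<beta> \<noteq> 0\<close> \<open>\<gamma> \<ge> 0\<close> by (intro divide_neg_pos) (auto intro!: mult_pos_pos)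
  ultimately show False using assms(1)[of "- \<beta> / (\<gamma> + 1)"] by linarith
qed

text \<open>The polarization of \<open>H1_normsq\<close>, hence half of its derivative at
  \<open>(v, g)\<close> in the direction \<open>(w, h)\<close>.\<close>

definition H1_form ::
  "real \<Rightarrow> (real^'n::finite \<Rightarrow> complex) \<Rightarrow> (real^'n \<Rightarrow> complex^'n)
    \<Rightarrow> (real^'n \<Rightarrow> complex) \<Rightarrow> (real^'n \<Rightarrow> complex^'n) \<Rightarrow> real" where
  "H1_form V v g w h = (\<integral>y. g y \<bullet> h y + V * (v y \<bullet> w y) \<partial>lborel)"

lemma H1_normsq_expand:
  assumes "v \<in> L2" "g \<in> L2" "w \<in> L2" "h \<in> L2"
  shows "H1_normsq V (\<lambda>y. v y + t *\<^sub>R w y, \<lambda>y. g y + t *\<^sub>R h y)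
     = H1_normsq V (v, g) + 2 * t * H1_form V v g w h + t\<^sup>2 * H1_normsq V (w, h)"
proof -
  have expand: "(norm (x + t *\<^sub>R z))\<^sup>2 = (norm x)\<^sup>2 + 2 * t * (x \<bullet> z) + t\<^sup>2 * (norm z)\<^sup>2" for x z :: "'b::real_inner"
    unfolding power2_norm_eq_inner
    by (simp add: inner_add_left inner_add_right inner_commute[of z x] power2_eq_square algebra_simps)
  have "H1_normsq V (\<lambda>y. v y + t *\<^sub>R w y, \<lambda>y. g y + t *\<^sub>R h y)
     = (\<integral>y. ((norm (g y))\<^sup>2 + V * (norm (v y))\<^sup>2) + 2 * t * (g y \<bullet> h y + V * (v y \<bullet> w y))
          + t\<^sup>2 * ((norm (h y))\<^sup>2 + V * (norm (w y))\<^sup>2) \<partial>lborel)"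
    unfolding H1_normsq_def prod.case expand
    by (intro Bochner_Integration.integral_cong refl) (simp only: algebra_simps)
  also have "\<dots> = H1_normsq V (v, g) + 2 * t * H1_form V v g w h + t\<^sup>2 * H1_normsq V (w, h)"
    unfolding H1_normsq_def H1_form_def prod.case
    using assms[THEN L2_integrable] L2_integrable_inner[OF assms(1,3)] L2_integrable_inner[OF assms(2,4)]
    by (subst Bochner_Integration.integral_add; simp)+
  finally show ?thesis .
qed

text \<open>Serves twice: to bound the phase variations of the ground-state from below, and to
  compare \<open>v\<close> with the ground-energy at a neighbouring point.\<close>

lemma normsq_ge_of_ground_energy:
  assumes "p > 2" "V > 0" "(w, h) \<in> H1 V a" "N > 0"
    and "(1 / 2 - 1 / p) * N \<le> ground_energy p V a" "lp_int p w \<ge> N"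
  shows "H1_normsq V (w, h) \<ge> N"
proof (rule ccontr)
  assume "\<not> ?thesis"
  then have "H1_normsq V (w, h) / N < 1" using \<open>N > 0\<close> by simp
  then have "(H1_normsq V (w, h) / N) powr (p / 2) < 1 powr (p / 2)"
    using assms(1,4) H1_normsq_nonneg[OF assms(2), of "(w, h)"] by (intro powr_less_mono2) auto
  moreover have "1 \<le> lp_int p w / N" using assms(4,6) by simp
  ultimately show False using sobolev_of_ground_energy[OF assms(1-5)] by simp
qed

section \<open>Variations of a ground-state\<close>

text \<open>\<open>N\<close> is the common value in the Nehari identity. Dividing by it makes both
  sides of the Sobolev inequality equal to 1 at \<open>v\<close>.\<close>

locale ground_state =
  fixes p V :: real and a :: "'n::finite potential" and v :: "real^'n \<Rightarrow> complex"
    and g :: "real^'n \<Rightarrow> complex^'n" and N :: real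
  assumes p: "p > 2" and V: "V > 0" and H1: "(v, g) \<in> H1 V a" and N: "N > 0"
    and normsq_eq: "H1_normsq V (v, g) = N" and lp_eq: "lp_int p v = N"
    and minimal: "(1 / 2 - 1 / p) * N \<le> ground_energy p V a"
begin

lemmas L2 = H1_L2[OF H1]

lemma measurable_state [measurable]: "v \<in> borel_measurable borel" "g \<in> borel_measurable borel"
  using L2 by (auto dest: L2_measurable)

text \<open>The Bochner integral of a non-integrable function is 0 by convention, so the nonzero
  value \<open>N\<close> already puts \<open>v\<close> in L^p.\<close>

lemma lp_integrable: "integrable lborel (\<lambda>y. norm (v y) powr p)"
  using not_integrable_integral_eq lp_eq N unfolding lp_int_def by force

lemma sobolev: "(w, h) \<in> H1 V a \<Longrightarrow> lp_int p w / N \<le> (H1_normsq V (w, h) / N) powr (p / 2)"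
  using sobolev_of_ground_energy[OF p V _ N minimal] .

lemma variation_H1:
  assumes "has_grad \<theta> E" "\<And>y. norm (\<theta> y) \<le> K" "\<And>y. norm (E y) \<le> K"
  shows "(\<lambda>y. v y + t *\<^sub>R (\<theta> y * v y), \<lambda>y. g y + t *\<^sub>R (\<theta> y *s g y + v y *s E y)) \<in> H1 V a"
proof -
  have "has_grad (\<lambda>y. 1 + complex_of_real t * \<theta> y) (\<lambda>y. 0 + (complex_of_real t *s E y + \<theta> y *s 0))"
    by (intro has_grad_add has_grad_mult has_grad_const assms)
  moreover have "norm (1 + complex_of_real t * \<theta> y) \<le> 1 + \<bar>t\<bar> * K" for y
    using norm_triangle_ineq[of 1 "complex_of_real t * \<theta> y"] mult_left_mono[OF assms(2), of "\<bar>t\<bar>" y]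
    by (simp add: norm_mult)
  moreover have "norm (0 + (complex_of_real t *s E y + \<theta> y *s 0)) \<le> 1 + \<bar>t\<bar> * K" for y
    using mult_left_mono[OF assms(3), of "\<bar>t\<bar>" y] by (simp add: norm_smult)
  ultimately have "(\<lambda>y. (1 + complex_of_real t * \<theta> y) * v y,
      \<lambda>y. (1 + complex_of_real t * \<theta> y) *s g y + v y *s (0 + (complex_of_real t *s E y + \<theta> y *s 0))) \<in> H1 V a"
    by (rule H1_mult_same[OF V H1])
  moreover have "(\<lambda>y. (1 + complex_of_real t * \<theta> y) * v y) = (\<lambda>y. v y + t *\<^sub>R (\<theta> y * v y))"
    by (simp add: fun_eq_iff scaleR_conv_of_real algebra_simps)
  moreover have "(\<lambda>y. (1 + complex_of_real t * \<theta> y) *s g y + v y *s (0 + (complex_of_real t *s E y + \<theta> y *s 0)))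
      = (\<lambda>y. g y + t *\<^sub>R (\<theta> y *s g y + v y *s E y))"
    by (simp add: fun_eq_iff vec_eq_iff scaleR_conv_of_real[where 'a = complex] algebra_simps)
  ultimately show ?thesis by simp
qed

lemma variation_L2:
  assumes "has_grad \<theta> E" "\<And>y. norm (\<theta> y) \<le> K" "\<And>y. norm (E y) \<le> K"
  shows "(\<lambda>y. \<theta> y * v y) \<in> L2" "(\<lambda>y. \<theta> y *s g y + v y *s E y) \<in> L2"
  using H1_L2[OF H1_mult_same[OF V H1 assms]] by auto

lemma lp_integrable_mult:
  assumes "\<eta> \<in> borel_measurable borel" "\<And>y. norm (\<eta> y) \<le> K"
  shows "integrable lborel (\<lambda>y. norm (\<eta> y * v y) powr p)"
proof (rule Bochner_Integration.integrable_bound)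
  show "integrable lborel (\<lambda>y. K powr p * norm (v y) powr p)"
    using lp_integrable by simp
  show "AE y in lborel. norm (norm (\<eta> y * v y) powr p) \<le> norm (K powr p * norm (v y) powr p)"
    using assms(2) p by (auto simp: norm_mult powr_mult intro!: AE_I2 mult_right_mono powr_mono2)
qed (use assms(1) in measurable)

text \<open>The variation \<open>(1 + \<i>t\<psi>)v\<close> does not decrease \<open>|v|\<close>, hence it does not decrease the norm, to
  first order in \<open>t\<close> of either sign. This is the weak form of the conservation of the current.\<close>

lemma phase_variation:
  assumes "has_grad (\<lambda>y. complex_of_real (\<psi> y)) E" "\<And>y. \<bar>\<psi> y\<bar> \<le> K" "\<And>y. norm (E y) \<le> K"
  shows "(\<integral>y. g y \<bullet> (v y *s (\<i> *s E y)) \<partial>lborel) = 0"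
proof -
  define \<theta> where "\<theta> = (\<lambda>y. \<i> * complex_of_real (\<psi> y))"
  have \<theta>: "has_grad \<theta> (\<lambda>y. \<i> *s E y)" "\<And>y. norm (\<theta> y) \<le> K" "\<And>y. norm (\<i> *s E y) \<le> K"
    using has_grad_mult[OF has_grad_const[of \<i>] assms(1)] assms(2,3)
    by (auto simp: \<theta>_def norm_mult norm_smult)
  note [measurable] = has_grad_measurable[OF \<theta>(1)]
  let ?w = "\<lambda>y. \<theta> y * v y" and ?h = "\<lambda>y. \<theta> y *s g y + v y *s (\<i> *s E y)"
  note wh = variation_L2[OF \<theta>]
  have "0 \<le> 2 * t * H1_form V v g ?w ?h + t\<^sup>2 * H1_normsq V (?w, ?h)" for t
  proof -
    have eq: "v y + t *\<^sub>R (\<theta> y * v y) = (1 + complex_of_real t * \<theta> y) * v y" for y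
      by (simp add: scaleR_conv_of_real algebra_simps)
    have ge: "norm (1 + complex_of_real t * \<theta> y) \<ge> 1" for y
      using abs_Re_le_cmod[of "1 + complex_of_real t * \<theta> y"] by (simp add: \<theta>_def)
    have le: "norm (1 + complex_of_real t * \<theta> y) \<le> 1 + \<bar>t\<bar> * K" for y
      using norm_triangle_ineq[of 1 "complex_of_real t * \<theta> y"] mult_left_mono[OF \<theta>(2), of "\<bar>t\<bar>" y]
      by (simp add: norm_mult)
    have "lp_int p v \<le> lp_int p (\<lambda>y. v y + t *\<^sub>R (\<theta> y * v y))"
      unfolding lp_int_def eq
    proof (rule integral_mono[OF lp_integrable lp_integrable_mult[OF _ le]])
      show "norm (v y) powr p \<le> norm ((1 + complex_of_real t * \<theta> y) * v y) powr p" for y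
        using mult_right_mono[OF ge[of y], of "norm (v y)"] p by (intro powr_mono2) (auto simp: norm_mult)
    qed simp
    then have "N \<le> H1_normsq V (\<lambda>y. v y + t *\<^sub>R ?w y, \<lambda>y. g y + t *\<^sub>R ?h y)"
      unfolding lp_eq by (rule normsq_ge_of_ground_energy[OF p V variation_H1[OF \<theta>] N minimal])
    then show ?thesis
      unfolding H1_normsq_expand[OF L2 wh] normsq_eq by simp
  qed
  then have "H1_form V v g ?w ?h = 0"
    by (rule quadratic_nonneg_imp_zero) (rule H1_normsq_nonneg[OF V])
  \<comment> \<open>Multiplication by \<open>\<theta>\<close> is skew for the real scalar product,
    so the terms without derivative of \<open>\<psi>\<close> vanish and only its gradient against
    the current remains.\<close>
  moreover have "g y \<bullet> ?h y + V * (v y \<bullet> ?w y) = g y \<bullet> (v y *s (\<i> *s E y))" for y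
  proof -
    have 0: "z \<bullet> (\<theta> y * z) = 0" for z :: complex
      by (simp add: \<theta>_def inner_complex_def algebra_simps)
    then have "g y \<bullet> (\<theta> y *s g y) = 0" by (simp add: inner_vec_def)
    with 0 show ?thesis by (simp add: inner_add_right)
  qed
  ultimately show ?thesis by (simp add: H1_form_def)
qed

text \<open>Compare \<open>v\<close> with \<open>(1 - s f) v\<close> for small s > 0: Bernoulli's
  inequality bounds the L^p integral below to first order, the Sobolev inequality bounds it above,
  and at s = 0 both are equalities. Only shrinking is tried, whence a one-sided conclusion.\<close>

lemma amplitude_variation:
  assumes "has_grad (\<lambda>y. complex_of_real (f y)) E" "\<And>y. 0 \<le> f y" "\<And>y. f y \<le> K" "\<And>y. norm (E y) \<le> K"
  shows "H1_form V v g (\<lambda>y. complex_of_real (f y) * v y) (\<lambda>y. complex_of_real (f y) *s g y + v y *s E y)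
      \<le> (\<integral>y. f y * norm (v y) powr p \<partial>lborel)"
proof (rule ccontr)
  let ?w = "\<lambda>y. complex_of_real (f y) * v y" and ?h = "\<lambda>y. complex_of_real (f y) *s g y + v y *s E y"
  define B where "B = H1_form V v g ?w ?h"
  define F where "F = (\<integral>y. f y * norm (v y) powr p \<partial>lborel)"
  define C where "C = H1_normsq V (?w, ?h)"
  assume "\<not> ?thesis"
  then have less: "F < B" by (simp add: B_def F_def)
  have nf: "norm (complex_of_real (f y)) \<le> K" for y using assms(2,3) by simp
  have "K \<ge> 0" using assms(2,3)[of 0] by simp
  note fv = assms(1) nf assms(4)
  have [measurable]: "f \<in> borel_measurable borel"
    using has_grad_measurable(1)[OF assms(1)] by (simp add: borel_measurable_complex_iff)
  note wh = variation_L2[OF fv]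
  have Fint: "integrable lborel (\<lambda>y. f y * norm (v y) powr p)"
    by (rule Bochner_Integration.integrable_bound[OF integrable_mult_right[OF lp_integrable, of K]])
       (use assms(2,3) \<open>K \<ge> 0\<close> in \<open>auto simp: abs_mult intro!: AE_I2 mult_right_mono\<close>)
  \<comment> \<open>The Sobolev bound minus the Bernoulli bound for the L^p integral of
    \<open>(1 - s f) v\<close>, divided by \<open>N\<close>; its slope at 0 is p (F - B) /
    N.\<close>
  define k where "k s = ((N - 2 * s * B + s\<^sup>2 * C) / N) powr (p / 2) - 1 + p * s * F / N" for s
  have k0: "k 0 = 0" using N by (simp add: k_def)
  \<comment> \<open>The range of \<open>s\<close> ensures \<open>s * f y < 1\<close>, as Bernoulli's
    inequality requires; \<open>K\<close> may be 0, hence \<open>K + 1\<close>.\<close>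
  have k_nonneg: "k s \<ge> 0" if s: "0 < s" "s < 1 / (K + 1)" for s
  proof -
    have sf: "s * f y < 1" for y
    proof -
      have "s * f y \<le> s * K" using s assms(3) by (intro mult_left_mono) auto
      also have "\<dots> < 1" using s \<open>K \<ge> 0\<close> by (simp add: field_simps)
      finally show ?thesis .
    qed
    have eq: "v y + (- s) *\<^sub>R ?w y = complex_of_real (1 - s * f y) * v y" for y
      by (simp add: scaleR_conv_of_real algebra_simps)
    have le1: "norm (complex_of_real (1 - s * f y)) \<le> 1" for y
      unfolding norm_of_real using sf[of y] s assms(2)[of y] by (simp add: abs_le_iff)
    have "(\<integral>y. norm (v y) powr p - p * s * (f y * norm (v y) powr p) \<partial>lborel) \<le> lp_int p (\<lambda>y. v y + (- s) *\<^sub>R ?w y)"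
      unfolding lp_int_def eq
    proof (rule integral_mono[OF _ lp_integrable_mult[OF _ le1]])
      show "integrable lborel (\<lambda>y. norm (v y) powr p - p * s * (f y * norm (v y) powr p))"
        using lp_integrable Fint by simp
      show "norm (v y) powr p - p * s * (f y * norm (v y) powr p) \<le> norm (complex_of_real (1 - s * f y) * v y) powr p" for y
      proof -
        have "(1 - p * (s * f y)) * norm (v y) powr p \<le> (1 - s * f y) powr p * norm (v y) powr p"
          using powr_one_minus_ge[OF _ sf[of y], of p] p by (intro mult_right_mono) auto
        also have "\<dots> = norm (complex_of_real (1 - s * f y) * v y) powr p"
          unfolding norm_mult norm_of_real using sf[of y] by (simp add: powr_mult)
        finally show ?thesis by (simp add: algebra_simps)
      qed
    qed measurable
    moreover have "(\<integral>y. norm (v y) powr p - p * s * (f y * norm (v y) powr p) \<partial>lborel) = N - p * s * F"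
      using lp_integrable Fint lp_eq by (simp add: F_def lp_int_def)
    ultimately have "(N - p * s * F) / N \<le> lp_int p (\<lambda>y. v y + (- s) *\<^sub>R ?w y) / N"
      using N by (intro divide_right_mono) auto
    also have "\<dots> \<le> (H1_normsq V (\<lambda>y. v y + (- s) *\<^sub>R ?w y, \<lambda>y. g y + (- s) *\<^sub>R ?h y) / N) powr (p / 2)"
      by (rule sobolev[OF variation_H1[OF fv]])
    finally show ?thesis
      unfolding H1_normsq_expand[OF L2 wh] normsq_eq using N
      by (simp add: k_def diff_divide_distrib flip: B_def C_def)
  qed
  have "DERIV k 0 :> p / 2 * (- 2 * B / N) + p * F / N"
    unfolding k_def[abs_def] using N by (auto intro!: derivative_eq_intros)
  moreover have "p / 2 * (- 2 * B / N) + p * F / N < 0"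
    using less N p by (simp add: field_simps)
  ultimately obtain d where d: "d > 0" "\<And>h. h > 0 \<Longrightarrow> h < d \<Longrightarrow> k 0 > k (0 + h)"
    using DERIV_neg_dec_right by blast
  define h where "h = min d (1 / (K + 1)) / 2"
  have "1 / (K + 1) > 0" using \<open>K \<ge> 0\<close> by simp
  with d(1) have "h > 0" "h < d" "h < 1 / (K + 1)" by (simp_all add: h_def min_less_iff_disj) (auto simp: min_def field_simps)
  with d(2)[of h] k_nonneg[of h] k0 show False by simp
qed

text \<open>The Euler--Lagrange inequality tested with \<open>r\<^sup>2v\<close>, after completing the square.\<close>

lemma localized_energy_le:
  assumes "has_grad (\<lambda>y. complex_of_real (r y)) E" "\<And>y. \<bar>r y\<bar> \<le> K" "\<And>y. norm (E y) \<le> K"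
  shows "H1_normsq V (\<lambda>y. complex_of_real (r y) * v y, \<lambda>y. complex_of_real (r y) *s g y + v y *s E y)
      \<le> (\<integral>y. (r y)\<^sup>2 * norm (v y) powr p \<partial>lborel) + (\<integral>y. (norm (v y *s E y))\<^sup>2 \<partial>lborel)"
proof -
  let ?w = "\<lambda>y. complex_of_real (r y) * v y" and ?h = "\<lambda>y. complex_of_real (r y) *s g y + v y *s E y"
  let ?E2 = "\<lambda>y. complex_of_real (r y) *s E y + complex_of_real (r y) *s E y"
  have nr: "norm (complex_of_real (r y)) \<le> K" for y using assms(2) by simp
  have "K \<ge> 0" using assms(2)[of 0] by simp
  note [measurable] = has_grad_measurable[OF assms(1)]
  have "has_grad (\<lambda>y. complex_of_real (r y) * complex_of_real (r y)) ?E2"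
    by (rule has_grad_mult[OF assms(1,1)])
  then have hg: "has_grad (\<lambda>y. complex_of_real ((r y)\<^sup>2)) ?E2"
    by (simp add: power2_eq_square)
  have "norm (complex_of_real (r y) *s E y) \<le> K * K" for y
    unfolding norm_smult using nr assms(3) \<open>K \<ge> 0\<close> by (intro mult_mono) auto
  then have "norm (?E2 y) \<le> K * K + K * K" for y
    by (intro norm_triangle_le add_mono)
  then have nE: "norm (?E2 y) \<le> 2 * K\<^sup>2" for y
    by (simp add: power2_eq_square)
  have "(r y)\<^sup>2 \<le> K\<^sup>2" for y
    using assms(2)[of y] power_mono[of "\<bar>r y\<bar>" K 2] by simp
  then have nf: "(r y)\<^sup>2 \<le> 2 * K\<^sup>2" for y
    by (smt (verit) zero_le_power2)
  have nr2: "norm (complex_of_real ((r y)\<^sup>2)) \<le> 2 * K\<^sup>2" for y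
    using nf[of y] unfolding norm_of_real by simp
  have "H1_form V v g (\<lambda>y. complex_of_real ((r y)\<^sup>2) * v y) (\<lambda>y. complex_of_real ((r y)\<^sup>2) *s g y + v y *s ?E2 y)
      \<le> (\<integral>y. (r y)\<^sup>2 * norm (v y) powr p \<partial>lborel)"
    by (rule amplitude_variation[OF hg _ nf nE]) simp
  moreover have "H1_normsq V (?w, ?h)
      = H1_form V v g (\<lambda>y. complex_of_real ((r y)\<^sup>2) * v y) (\<lambda>y. complex_of_real ((r y)\<^sup>2) *s g y + v y *s ?E2 y)
        + (\<integral>y. (norm (v y *s E y))\<^sup>2 \<partial>lborel)"
  proof -
    \<comment> \<open>The localization identity: for real \<open>r\<close> the square of r g + v E
      is the scalar product of g with r^2 g + 2 r v E, which is the covariant derivative of r^2 v,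
      plus the square of v E.\<close>
    have pt: "(norm (?h y))\<^sup>2 + V * (norm (?w y))\<^sup>2
       = (g y \<bullet> (complex_of_real ((r y)\<^sup>2) *s g y + v y *s ?E2 y) + V * (v y \<bullet> (complex_of_real ((r y)\<^sup>2) * v y)))
         + (norm (v y *s E y))\<^sup>2" for y
    proof -
      have s: "complex_of_real c *s x = c *\<^sub>R x" for c and x :: "complex^'n"
        by (simp add: vec_eq_iff scaleR_conv_of_real[where 'a = complex])
      have m: "complex_of_real c * x = c *\<^sub>R x" for c x
        by (simp add: scaleR_conv_of_real)
      have "v y *s ?E2 y = (2 * r y) *\<^sub>R (v y *s E y)"
        by (simp add: vec_eq_iff scaleR_conv_of_real[where 'a = complex] algebra_simps)
      then show ?thesis
        unfolding s m power2_norm_eq_inner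
        by (simp add: inner_add_left inner_add_right inner_commute[of "v y *s E y" "g y"] power2_eq_square algebra_simps)
    qed
    have "(\<lambda>y. v y *s E y) \<in> L2"
      by (rule L2_smult_vec[OF L2(1) _ assms(3)]) simp
    note l2 = L2_integrable[OF this] variation_L2[OF hg nr2 nE]
    show ?thesis
      unfolding H1_normsq_def H1_form_def prod.case pt
      by (rule Bochner_Integration.integral_add[OF _ l2(1)])
         (intro Bochner_Integration.integrable_add integrable_mult_right L2_integrable_inner[OF L2(2) l2(3)] L2_integrable_inner[OF L2(1) l2(2)])
  qed
  ultimately show ?thesis by simp
qed

lemma lp_tail_small:
  assumes "\<delta> > 0"
  obtains R where "R \<ge> 0" "(\<integral>y. indicator {y. norm y > R} y * norm (v y) powr p \<partial>lborel) < \<delta>"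
proof -
  have "(\<lambda>k. \<integral>y. indicator {y. norm y > real k} y * norm (v y) powr p \<partial>lborel) \<longlonglongrightarrow> (\<integral>y. 0 \<partial>(lborel :: (real^'n) measure))"
  proof (rule integral_dominated_convergence[where w = "\<lambda>y. norm (v y) powr p"])
    show "AE y in lborel. (\<lambda>k. indicator {y. norm y > real k} y * norm (v y) powr p) \<longlonglongrightarrow> 0"
    proof (rule AE_I2)
      fix y :: "real^'n"
      obtain n where "norm y \<le> real n" using real_arch_simple by blast
      then have "\<forall>\<^sub>F k in sequentially. indicator {y. norm y > real k} y * norm (v y) powr p = 0"
        by (auto simp: eventually_sequentially intro!: exI[of _ n])
      then show "(\<lambda>k. indicator {y. norm y > real k} y * norm (v y) powr p) \<longlonglongrightarrow> 0"
        by (rule tendsto_eventually)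
    qed
  qed (use lp_integrable in \<open>auto simp: indicator_def\<close>)
  then have "(\<lambda>k. \<integral>y. indicator {y. norm y > real k} y * norm (v y) powr p \<partial>lborel) \<longlonglongrightarrow> 0"
    by simp
  then have "\<forall>\<^sub>F k in sequentially. (\<integral>y. indicator {y. norm y > real k} y * norm (v y) powr p \<partial>lborel) < \<delta>"
    using assms by (rule order_tendstoD)
  then obtain k where "(\<integral>y. indicator {y. norm y > real k} y * norm (v y) powr p \<partial>lborel) < \<delta>"
    by (auto simp: eventually_sequentially)
  then show ?thesis by (intro that[of "real k"]) auto
qed

text \<open>Outside a large ball the nonlinear term is absorbed by the Sobolev inequality.\<close>

lemma localized_energy_bound:
  "\<exists>C. \<forall>r E K. has_grad (\<lambda>y. complex_of_real (r y)) E \<longrightarrow> (\<forall>y. \<bar>r y\<bar> \<le> K) \<longrightarrow>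
      (\<forall>y. \<bar>r y\<bar> \<le> norm y) \<longrightarrow> (\<forall>y. norm (E y) \<le> M) \<longrightarrow>
      H1_normsq V (\<lambda>y. complex_of_real (r y) * v y, \<lambda>y. complex_of_real (r y) *s g y + v y *s E y) \<le> C"
proof -
  \<comment> \<open>Since p (1 - \<alpha>) = 2, the integrand r^2 |v|^p splits into the power
    \<alpha> of |v|^p and the power 1 - \<alpha> of |r v|^p. On the second factor the Sobolev
    exponent p / 2 becomes 1, so the bound is linear in \<open>n\<close>.\<close>
  define \<alpha> where "\<alpha> = 1 - 2 / p"
  have \<alpha>: "0 < \<alpha>" "\<alpha> < 1" using p by (auto simp: \<alpha>_def)
  \<comment> \<open>The threshold for the tail \<open>X\<close> is the one that gives
    \<open>X_half\<close>, so that the nonlinear term outside the ball costs at most n / 2.\<close>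
  have "N * (1 / 2) powr (1 / \<alpha>) > 0" using N by simp
  then obtain R where R: "R \<ge> 0" "(\<integral>y. indicator {y. norm y > R} y * norm (v y) powr p \<partial>lborel) < N * (1 / 2) powr (1 / \<alpha>)"
    by (rule lp_tail_small)
  define X where "X = (\<integral>y. indicator {y. norm y > R} y * norm (v y) powr p \<partial>lborel)"
  have "X \<ge> 0" unfolding X_def by (intro integral_nonneg_AE AE_I2) auto
  have Xint: "integrable lborel (\<lambda>y. indicator {y. norm y > R} y * norm (v y) powr p)"
    by (rule Bochner_Integration.integrable_bound[OF lp_integrable]) (auto simp: indicator_def)
  have "(X / N) powr \<alpha> \<le> ((1 / 2) powr (1 / \<alpha>)) powr \<alpha>"
    using R(2) \<open>X \<ge> 0\<close> N \<alpha> by (intro powr_mono2) (auto simp: X_def field_simps)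
  then have X_half: "(X / N) powr \<alpha> \<le> 1 / 2" using \<alpha> by (simp add: powr_powr)
  define q where "q = (\<integral>y. (norm (v y))\<^sup>2 \<partial>lborel)"
  show ?thesis
  \<comment> \<open>Obtained by solving n \<le> R^2 N + n / 2 + M^2 q for \<open>n\<close>. Neither
    \<open>r\<close> nor its bound \<open>K\<close> enters, so the constant survives the removal of
    the cutoff.\<close>
  proof (intro exI[of _ "2 * R\<^sup>2 * N + 2 * M\<^sup>2 * q"] allI impI)
    fix r :: "real^'n \<Rightarrow> real" and E :: "real^'n \<Rightarrow> complex^'n" and K :: real
    assume asms: "has_grad (\<lambda>y. complex_of_real (r y)) E" "\<forall>y. \<bar>r y\<bar> \<le> K"
      "\<forall>y. \<bar>r y\<bar> \<le> norm y" "\<forall>y. norm (E y) \<le> M"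
    then have rE: "has_grad (\<lambda>y. complex_of_real (r y)) E" "\<And>y. \<bar>r y\<bar> \<le> K"
      and r_le: "\<And>y. \<bar>r y\<bar> \<le> norm y" and E_le: "\<And>y. norm (E y) \<le> M"
      by blast+
    let ?w = "\<lambda>y. complex_of_real (r y) * v y" and ?h = "\<lambda>y. complex_of_real (r y) *s g y + v y *s E y"
    define n where "n = H1_normsq V (?w, ?h)"
    have "n \<ge> 0" unfolding n_def by (rule H1_normsq_nonneg[OF V])
    note [measurable] = has_grad_measurable[OF rE(1)]
    have [measurable]: "r \<in> borel_measurable borel"
      using has_grad_measurable(1)[OF rE(1)] by (simp add: borel_measurable_complex_iff)
    have K': "\<bar>r y\<bar> \<le> max K M" "norm (E y) \<le> max K M" for y
      using rE(2) E_le by (auto simp: le_max_iff_disj)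
    have cr: "norm (complex_of_real (r y)) \<le> max K M" for y using K' by simp
    have mem: "(?w, ?h) \<in> H1 V a"
      by (rule H1_mult_same[OF V H1 rE(1) cr K'(2)])
    have wint: "integrable lborel (\<lambda>y. norm (?w y) powr p)"
      by (rule lp_integrable_mult[OF _ cr]) simp
    define Y where "Y = (\<integral>y. indicator {y. norm y > R} y * ((r y)\<^sup>2 * norm (v y) powr p) \<partial>lborel)"
    have "Y \<le> n / 2"
    proof -
      have "indicator {y. norm y > R} y * ((r y)\<^sup>2 * norm (v y) powr p)
         = (indicator {y. norm y > R} y * norm (v y) powr p) powr \<alpha> * (norm (?w y) powr p) powr (1 - \<alpha>)" for y
      proof (cases "norm y > R")
        case True
        have A: "norm (v y) powr p = norm (v y) powr (p * \<alpha>) * norm (v y) powr 2"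
          using p by (simp add: \<alpha>_def right_diff_distrib flip: powr_add del: powr_numeral)
        have B: "(norm (?w y) powr p) powr (1 - \<alpha>) = \<bar>r y\<bar> powr 2 * norm (v y) powr 2"
        proof -
          have "p * (1 - \<alpha>) = 2" using p by (simp add: \<alpha>_def)
          then show ?thesis
            unfolding powr_powr by (simp add: norm_mult powr_mult del: powr_numeral)
        qed
        have "(indicator {y. norm y > R} y * norm (v y) powr p) powr \<alpha> = norm (v y) powr (p * \<alpha>)"
          using True by (simp add: powr_powr)
        then show ?thesis
          unfolding B using True A by simp
      qed simp
      then have "Y \<le> X powr \<alpha> * lp_int p ?w powr (1 - \<alpha>)"
        unfolding Y_def X_def lp_int_def using Holder_integral[OF Xint wint _ _ \<alpha>] by simp
      also have "\<dots> \<le> X powr \<alpha> * (N powr (1 - \<alpha>) * (n / N))"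
      proof (rule mult_left_mono)
        have "(lp_int p ?w / N) powr (1 - \<alpha>) \<le> ((n / N) powr (p / 2)) powr (1 - \<alpha>)"
          using sobolev[OF mem] \<alpha> N lp_int_nonneg[of p ?w] by (intro powr_mono2) (auto simp: n_def)
        also have "\<dots> = n / N" using p \<open>n \<ge> 0\<close> N by (simp add: powr_powr \<alpha>_def)
        finally have "N powr (1 - \<alpha>) * (lp_int p ?w / N) powr (1 - \<alpha>) \<le> N powr (1 - \<alpha>) * (n / N)"
          by (rule mult_left_mono) simp
        then show "lp_int p ?w powr (1 - \<alpha>) \<le> N powr (1 - \<alpha>) * (n / N)"
          using N lp_int_nonneg[of p ?w] by (simp add: powr_divide)
      qed simp
      also have "\<dots> = (X / N) powr \<alpha> * n"
        using N \<open>X \<ge> 0\<close> by (simp add: powr_divide powr_diff)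
      also have "\<dots> \<le> 1 / 2 * n"
        using X_half \<open>n \<ge> 0\<close> by (rule mult_right_mono)
      finally show ?thesis by simp
    qed
    have r2K: "(r y)\<^sup>2 \<le> K\<^sup>2" for y
      using rE(2)[of y] power_mono[of "\<bar>r y\<bar>" K 2] by simp
    have rint: "integrable lborel (\<lambda>y. (r y)\<^sup>2 * norm (v y) powr p)"
      by (rule Bochner_Integration.integrable_bound[OF integrable_mult_right[OF lp_integrable, of "K\<^sup>2"]])
         (use r2K in \<open>auto intro!: AE_I2 mult_right_mono\<close>)
    have Yint: "integrable lborel (\<lambda>y. indicator {y. norm y > R} y * ((r y)\<^sup>2 * norm (v y) powr p))"
      by (rule Bochner_Integration.integrable_bound[OF rint]) (auto simp: indicator_def)
    have "(\<integral>y. (r y)\<^sup>2 * norm (v y) powr p \<partial>lborel)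
        \<le> (\<integral>y. R\<^sup>2 * norm (v y) powr p + indicator {y. norm y > R} y * ((r y)\<^sup>2 * norm (v y) powr p) \<partial>lborel)"
    proof (rule integral_mono[OF rint])
      show "integrable lborel (\<lambda>y. R\<^sup>2 * norm (v y) powr p + indicator {y. norm y > R} y * ((r y)\<^sup>2 * norm (v y) powr p))"
        using lp_integrable Yint by simp
      show "(r y)\<^sup>2 * norm (v y) powr p \<le> R\<^sup>2 * norm (v y) powr p + indicator {y. norm y > R} y * ((r y)\<^sup>2 * norm (v y) powr p)" for y
      proof (cases "norm y > R")
        case False
        then have "\<bar>r y\<bar> \<le> R" using r_le[of y] by linarith
        then have "(r y)\<^sup>2 \<le> R\<^sup>2" using power_mono[of "\<bar>r y\<bar>" R 2] by simp
        then show ?thesis using False by (simp add: mult_right_mono)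
      qed simp
    qed
    also have "\<dots> = R\<^sup>2 * N + Y"
      using lp_integrable Yint lp_eq by (simp add: Y_def lp_int_def)
    finally have 1: "(\<integral>y. (r y)\<^sup>2 * norm (v y) powr p \<partial>lborel) \<le> R\<^sup>2 * N + Y" .
    have 2: "(\<integral>y. (norm (v y *s E y))\<^sup>2 \<partial>lborel) \<le> M\<^sup>2 * q"
    proof -
      have "(\<lambda>y. v y *s E y) \<in> L2"
        by (rule L2_smult_vec[OF L2(1) _ E_le]) simp
      moreover have "(norm (v y *s E y))\<^sup>2 \<le> M\<^sup>2 * (norm (v y))\<^sup>2" for y
        using power_mono[OF E_le[of y], of 2] by (simp add: norm_smult power_mult_distrib mult.commute[of "M\<^sup>2"] mult_left_mono)
      ultimately have "(\<integral>y. (norm (v y *s E y))\<^sup>2 \<partial>lborel) \<le> (\<integral>y. M\<^sup>2 * (norm (v y))\<^sup>2 \<partial>lborel)"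
        using L2_integrable[OF L2(1)] by (intro integral_mono) (auto dest: L2_integrable)
      then show ?thesis by (simp add: q_def)
    qed
    have "n \<le> (R\<^sup>2 * N + n / 2) + M\<^sup>2 * q"
      using localized_energy_le[OF rE(1) K'] 1 2 \<open>Y \<le> n / 2\<close> unfolding n_def[symmetric] by linarith
    then show "H1_normsq V (?w, ?h) \<le> 2 * R\<^sup>2 * N + 2 * M\<^sup>2 * q"
      unfolding n_def[symmetric] by linarith
  qed
qed

end

section \<open>Bivectors in coordinates\<close>

lemma wedge_expand: "wedge y z = (\<Sum>k\<in>UNIV. y $ k *\<^sub>R wedge (axis k 1) z)"
proof -
  have y: "(\<Sum>k\<in>UNIV. y $ k * axis k 1 $ i) = y $ i" for i
    using basis_expansion[of y] by (simp add: vec_eq_iff)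
  have "y $ i * z $ j - z $ i * y $ j = (\<Sum>k\<in>UNIV. y $ k * (axis k 1 $ i * z $ j - z $ i * axis k 1 $ j))" for i j
  proof -
    have "(\<Sum>k\<in>UNIV. y $ k * (axis k 1 $ i * z $ j - z $ i * axis k 1 $ j))
      = (\<Sum>k\<in>UNIV. (y $ k * axis k 1 $ i) * z $ j - (y $ k * axis k 1 $ j) * z $ i)"
      by (intro sum.cong) (auto simp: algebra_simps)
    also have "\<dots> = y $ i * z $ j - y $ j * z $ i"
      by (simp only: sum_subtractf y flip: sum_distrib_right)
    finally show ?thesis by (simp add: mult.commute)
  qed
  then show ?thesis by (simp add: wedge_def vec_eq_iff)
qed

lemma pairing_sum: "pairing \<alpha> (\<Sum>i\<in>I. m i) = (\<Sum>i\<in>I. pairing \<alpha> (m i))"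
proof (induction I rule: infinite_finite_induct)
  case (insert x F)
  then show ?case by (simp add: pairing_def distrib_left sum.distrib)
qed (simp_all add: pairing_def)

lemma pairing_scaleR: "pairing \<alpha> (c *\<^sub>R m) = c * pairing \<alpha> m"
  by (simp add: pairing_def sum_distrib_left mult_ac)

section \<open>Decay and moments of a ground-state\<close>

context ground_state
begin

text \<open>The energy bound is uniform over the weights: each is dominated by |y| and has gradient
  at most 3, although the bound \<open>1 / \<epsilon> k\<close> on its size blows up. Fatou's lemma
  passes to the limit.\<close>

lemma coord_L2: "(\<lambda>y. y $ i *\<^sub>R v y) \<in> L2"
proof -
  define \<epsilon> where "\<epsilon> k = 1 / real (Suc k)" for k
  have \<epsilon>: "0 < \<epsilon> k" "\<epsilon> k \<le> 1" for k by (auto simp: \<epsilon>_def)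
  define r where "r k y = y $ i * inverse (1 + \<epsilon> k * (norm y)\<^sup>2)" for k and y :: "real^'n"
  have r_eq: "complex_of_real (r k y) = complex_of_real (y $ i) * cutoff (\<epsilon> k) y" for k y
    by (simp add: r_def cutoff_def)
  have r_abs: "\<bar>r k y\<bar> = \<bar>y $ i\<bar> * norm (cutoff (\<epsilon> k) y)" for k y
    using arg_cong[OF r_eq[of k y], of norm] by (simp add: norm_mult)
  obtain C where C: "\<And>r E K. has_grad (\<lambda>y. complex_of_real (r y)) E \<Longrightarrow> (\<And>y. \<bar>r y\<bar> \<le> K) \<Longrightarrow>
      (\<And>y. \<bar>r y\<bar> \<le> norm y) \<Longrightarrow> (\<And>y. norm (E y) \<le> 3) \<Longrightarrow>
      H1_normsq V (\<lambda>y. complex_of_real (r y) * v y, \<lambda>y. complex_of_real (r y) *s g y + v y *s E y) \<le> C"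
    using localized_energy_bound[of 3] by blast
  have bound: "(\<integral>\<^sup>+ y. ennreal ((norm (r k y *\<^sub>R v y))\<^sup>2) \<partial>lborel) \<le> ennreal (C / V)" for k
  proof -
    let ?E = "\<lambda>y. complex_of_real (y $ i) *s grad_cutoff (\<epsilon> k) y + cutoff (\<epsilon> k) y *s axis i 1"
    note cb = cutoff_bounds[OF \<epsilon>(1)[of k] \<epsilon>(2)[of k]]
    have grad: "has_grad (\<lambda>y. complex_of_real (r k y)) ?E"
      unfolding r_eq by (intro has_grad_mult has_grad_coord has_grad_cutoff less_imp_le \<epsilon>)
    have K: "\<bar>r k y\<bar> \<le> 1 / \<epsilon> k" for y
      using mult_right_mono[OF component_le_norm_cart, of "norm (cutoff (\<epsilon> k) y)" y i] cb(5)[of y]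
      unfolding r_abs by simp
    have le: "\<bar>r k y\<bar> \<le> norm y" for y
      using mult_mono[OF component_le_norm_cart[of y i] cb(1)[of y]] unfolding r_abs by simp
    \<comment> \<open>2 comes from \<open>y $ i\<close> times the gradient of the cutoff, 1 from the
      cutoff times the gradient of \<open>y $ i\<close>.\<close>
    have "norm (?E y) \<le> 2 + 1" for y
    proof (intro norm_triangle_le add_mono)
      show "norm (complex_of_real (y $ i) *s grad_cutoff (\<epsilon> k) y) \<le> 2"
        using mult_right_mono[OF component_le_norm_cart, of "norm (grad_cutoff (\<epsilon> k) y)" y i] cb(4)[of y]
        by (simp add: norm_smult)
      show "norm (cutoff (\<epsilon> k) y *s axis i 1) \<le> 1"
        using cb(1)[of y] by (simp add: norm_smult)
    qed
    then have E: "norm (?E y) \<le> 3" for y by simp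
    let ?w = "\<lambda>y. complex_of_real (r k y) * v y" and ?h = "\<lambda>y. complex_of_real (r k y) *s g y + v y *s ?E y"
    have "norm (complex_of_real (r k y)) \<le> max (1 / \<epsilon> k) 3" "norm (?E y) \<le> max (1 / \<epsilon> k) 3" for y
      using K[of y] E[of y] by (simp_all add: le_max_iff_disj del: of_real_mult)
    then have L: "?w \<in> L2" "?h \<in> L2"
      using variation_L2[OF grad] by blast+
    have "V * (\<integral>y. (norm (?w y))\<^sup>2 \<partial>lborel) \<le> H1_normsq V (?w, ?h)"
      unfolding H1_normsq_eq[OF L] by simp
    also have "\<dots> \<le> C" by (rule C[OF grad K le E])
    finally have "(\<integral>y. (norm (?w y))\<^sup>2 \<partial>lborel) \<le> C / V" using V by (simp add: field_simps)
    moreover have "(\<integral>\<^sup>+ y. ennreal ((norm (?w y))\<^sup>2) \<partial>lborel) = ennreal (\<integral>y. (norm (?w y))\<^sup>2 \<partial>lborel)"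
      using L2_integrable[OF L(1)] by (intro nn_integral_eq_integral) auto
    ultimately show ?thesis by (simp add: scaleR_conv_of_real ennreal_leI)
  qed
  have [measurable]: "r k \<in> borel_measurable borel" for k
    unfolding r_def[abs_def] by measurable
  have lim: "(\<lambda>k. ennreal ((norm (r k y *\<^sub>R v y))\<^sup>2)) \<longlonglongrightarrow> ennreal ((norm (y $ i *\<^sub>R v y))\<^sup>2)" for y
  proof -
    have "(\<lambda>k. complex_of_real (y $ i) * cutoff (\<epsilon> k) y) \<longlonglongrightarrow> complex_of_real (y $ i) * 1"
      unfolding \<epsilon>_def by (intro tendsto_intros cutoff_tendsto)
    then have "(\<lambda>k. (norm (complex_of_real (r k y) * v y))\<^sup>2) \<longlonglongrightarrow> (norm (complex_of_real (y $ i) * 1 * v y))\<^sup>2"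
      unfolding r_eq by (intro tendsto_power tendsto_norm tendsto_mult[OF _ tendsto_const])
    then show ?thesis by (intro tendsto_ennrealI) (simp add: scaleR_conv_of_real)
  qed
  have "(\<integral>\<^sup>+ y. ennreal ((norm (y $ i *\<^sub>R v y))\<^sup>2) \<partial>lborel)
      = (\<integral>\<^sup>+ y. liminf (\<lambda>k. ennreal ((norm (r k y *\<^sub>R v y))\<^sup>2)) \<partial>lborel)"
    using lim_imp_Liminf[OF _ lim] by simp
  also have "\<dots> \<le> liminf (\<lambda>k. \<integral>\<^sup>+ y. ennreal ((norm (r k y *\<^sub>R v y))\<^sup>2) \<partial>lborel)"
    by (rule nn_integral_liminf) measurable
  also have "\<dots> \<le> ennreal (C / V)"
    by (intro Liminf_le always_eventually allI bound) simp
  finally have "(\<integral>\<^sup>+ y. ennreal ((norm (y $ i *\<^sub>R v y))\<^sup>2) \<partial>lborel) < \<infinity>"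
    by (rule le_less_trans) simp
  then have "integrable lborel (\<lambda>y. (norm (y $ i *\<^sub>R v y))\<^sup>2)"
    by (intro integrableI_bounded) auto
  then show ?thesis by (intro L2_I) auto
qed

lemma norm_L2: "(\<lambda>y. norm y *\<^sub>R v y) \<in> L2"
proof (rule L2_I)
  have "integrable lborel (\<lambda>y. \<Sum>i\<in>UNIV. (norm (y $ i *\<^sub>R v y))\<^sup>2)"
    using L2_integrable[OF coord_L2] by simp
  moreover have "(\<Sum>i\<in>UNIV. (norm (y $ i *\<^sub>R v y))\<^sup>2) = (norm (norm y *\<^sub>R v y))\<^sup>2" for y
    by (simp add: power_mult_distrib norm_vec_def L2_set_def sum_nonneg sum_distrib_right)
  ultimately show "integrable lborel (\<lambda>y. (norm (norm y *\<^sub>R v y))\<^sup>2)" by simp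
qed measurable

text \<open>The scalar product with \<open>\<i> * v y\<close> is component \<open>j\<close> of the
  current.\<close>

definition moment :: "'n \<Rightarrow> 'n \<Rightarrow> real" where
  "moment i j = (\<integral>y. y $ i * (g y $ j \<bullet> (\<i> * v y)) \<partial>lborel)"

lemma moment_integrable: "integrable lborel (\<lambda>y. y $ i * (g y $ j \<bullet> (\<i> * v y)))"
proof (rule Bochner_Integration.integrable_bound[OF L2_integrable_norm_mult[OF L2(2) coord_L2[of i]]])
  show "AE y in lborel. norm (y $ i * (g y $ j \<bullet> (\<i> * v y))) \<le> norm (norm (g y) * norm (y $ i *\<^sub>R v y))"
  proof (rule AE_I2)
    fix y
    have "\<bar>g y $ j \<bullet> (\<i> * v y)\<bar> \<le> norm (g y $ j) * norm (\<i> * v y)"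
      by (rule Cauchy_Schwarz_ineq2)
    also have "\<dots> \<le> norm (g y) * norm (v y)"
      by (simp add: norm_mult mult_right_mono Finite_Cartesian_Product.norm_nth_le)
    finally have "\<bar>y $ i\<bar> * \<bar>g y $ j \<bullet> (\<i> * v y)\<bar> \<le> \<bar>y $ i\<bar> * (norm (g y) * norm (v y))"
      by (rule mult_left_mono) simp
    then show "norm (y $ i * (g y $ j \<bullet> (\<i> * v y))) \<le> norm (norm (g y) * norm (y $ i *\<^sub>R v y))"
      by (simp add: abs_mult mult_ac)
  qed
qed measurable

text \<open>Take \<psi> = y_i y_j in \<open>phase_variation\<close>: its gradient y_i e_j + y_j e_i,
  paired with the current, gives the symmetric part of the moments. As this \<psi> is unbounded, it
  is multiplied by the cutoff, and the decay of \<open>v\<close> dominates the limit.\<close>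

lemma moment_antisym: "moment i j = - moment j i"
proof -
  define \<epsilon> where "\<epsilon> k = 1 / real (Suc k)" for k
  have \<epsilon>: "0 < \<epsilon> k" "\<epsilon> k \<le> 1" for k by (auto simp: \<epsilon>_def)
  note cb = cutoff_bounds[OF \<epsilon>]
  let ?c = "\<lambda>y i. complex_of_real (y $ i)"
  define E where "E k y = ?c y i *s (?c y j *s grad_cutoff (\<epsilon> k) y + cutoff (\<epsilon> k) y *s axis j 1)
      + (?c y j * cutoff (\<epsilon> k) y) *s axis i 1" for k y
  have ci: "\<bar>y $ i\<bar> \<le> norm y" for y :: "real^'n" and i by (rule component_le_norm_cart)
  have E_le: "norm (E k y) \<le> (norm y)\<^sup>2 * norm (grad_cutoff (\<epsilon> k) y) + 2 * (norm y * norm (cutoff (\<epsilon> k) y))" for k y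
  proof -
    have "E k y = (?c y i * ?c y j) *s grad_cutoff (\<epsilon> k) y + ((?c y i * cutoff (\<epsilon> k) y) *s axis j 1
      + (?c y j * cutoff (\<epsilon> k) y) *s axis i 1)"
      by (simp add: E_def vec_eq_iff algebra_simps)
    moreover have "norm ((?c y i * ?c y j) *s grad_cutoff (\<epsilon> k) y) \<le> (norm y)\<^sup>2 * norm (grad_cutoff (\<epsilon> k) y)"
      unfolding norm_smult norm_mult power2_eq_square using ci by (intro mult_mono) auto
    moreover have "norm ((?c y l * cutoff (\<epsilon> k) y) *s axis m 1 :: complex^'n) \<le> norm y * norm (cutoff (\<epsilon> k) y)" for l m
      unfolding norm_smult norm_mult using ci[of y l] by (auto intro!: mult_right_mono)
    ultimately show ?thesis
      by (smt (verit) norm_triangle_ineq)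
  qed
  have zero: "(\<integral>y. g y \<bullet> (v y *s (\<i> *s E k y)) \<partial>lborel) = 0" for k
  proof (rule phase_variation)
    let ?\<psi> = "\<lambda>y. y $ i * (y $ j * inverse (1 + \<epsilon> k * (norm y)\<^sup>2))"
    have eq: "complex_of_real (?\<psi> y) = ?c y i * (?c y j * cutoff (\<epsilon> k) y)" for y
      by (simp add: cutoff_def)
    show "has_grad (\<lambda>y. complex_of_real (?\<psi> y)) (E k)"
      unfolding eq E_def[abs_def] by (intro has_grad_mult has_grad_coord has_grad_cutoff less_imp_le \<epsilon>)
    \<comment> \<open>\<open>phase_variation\<close> takes one bound for the function and its
      gradient; the gradient needs 1 / \<epsilon> + 2 / \<epsilon>.\<close>
    show "\<bar>?\<psi> y\<bar> \<le> 3 / \<epsilon> k" for y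
    proof -
      have "\<bar>?\<psi> y\<bar> = norm (?c y i * (?c y j * cutoff (\<epsilon> k) y))"
        by (simp only: norm_of_real flip: eq)
      also have "\<dots> \<le> norm y * (norm y * norm (cutoff (\<epsilon> k) y))"
        unfolding norm_mult using ci by (intro mult_mono) auto
      also have "\<dots> \<le> 1 / \<epsilon> k" using cb(6)[of y k] by (simp add: power2_eq_square mult_ac)
      also have "\<dots> \<le> 3 / \<epsilon> k" using \<epsilon>[of k] by (intro divide_right_mono) auto
      finally show ?thesis .
    qed
    show "norm (E k y) \<le> 3 / \<epsilon> k" for y
      using E_le[of k y] cb(5,7)[of y k] by simp
  qed
  have [measurable]: "E k \<in> borel_measurable borel" for k
  proof -
    have "has_grad (\<lambda>y. ?c y i * (?c y j * cutoff (\<epsilon> k) y)) (E k)"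
      unfolding E_def[abs_def] by (intro has_grad_mult has_grad_coord has_grad_cutoff less_imp_le \<epsilon>)
    then show ?thesis by (rule has_grad_measurable)
  qed
  define L where "L y = ?c y i *s axis j 1 + ?c y j *s axis i (1::complex)" for y :: "real^'n"
  have [measurable]: "L \<in> borel_measurable borel"
    unfolding L_def[abs_def] by measurable
  have "(\<lambda>k. \<integral>y. g y \<bullet> (v y *s (\<i> *s E k y)) \<partial>lborel) \<longlonglongrightarrow> (\<integral>y. g y \<bullet> (v y *s (\<i> *s L y)) \<partial>lborel)"
  \<comment> \<open>By \<open>E_le\<close>: the quadratic factor times the gradient of the cutoff is
    at most 2 |y|, and the two other terms are at most |y| each, together 4 |y|.\<close>
  proof (rule integral_dominated_convergence[where w = "\<lambda>y. 4 * (norm (g y) * norm (norm y *\<^sub>R v y))"])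
    show "integrable lborel (\<lambda>y. 4 * (norm (g y) * norm (norm y *\<^sub>R v y)))"
      by (intro integrable_mult_right L2_integrable_norm_mult L2 norm_L2)
    show "AE y in lborel. (\<lambda>k. g y \<bullet> (v y *s (\<i> *s E k y))) \<longlonglongrightarrow> g y \<bullet> (v y *s (\<i> *s L y))"
    proof (rule AE_I2)
      fix y :: "real^'n"
      have "(\<lambda>k. E k y) \<longlonglongrightarrow> ?c y i *s (?c y j *s 0 + 1 *s axis j 1) + (?c y j * 1) *s axis i 1"
        unfolding E_def \<epsilon>_def
        by (intro tendsto_intros bounded_bilinear.tendsto[OF bounded_bilinear_smult] cutoff_tendsto)
      then have "(\<lambda>k. E k y) \<longlonglongrightarrow> L y" by (simp add: L_def)
      then show "(\<lambda>k. g y \<bullet> (v y *s (\<i> *s E k y))) \<longlonglongrightarrow> g y \<bullet> (v y *s (\<i> *s L y))"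
        by (intro tendsto_intros bounded_bilinear.tendsto[OF bounded_bilinear_smult])
    qed
    show "AE y in lborel. norm (g y \<bullet> (v y *s (\<i> *s E k y))) \<le> 4 * (norm (g y) * norm (norm y *\<^sub>R v y))" for k
    proof (rule AE_I2)
      fix y :: "real^'n"
      have "(norm y)\<^sup>2 * norm (grad_cutoff (\<epsilon> k) y) \<le> norm y * 2"
        using mult_left_mono[OF cb(4)[of y k], of "norm y"] by (simp add: power2_eq_square mult.assoc)
      moreover have "norm y * norm (cutoff (\<epsilon> k) y) \<le> norm y"
        using mult_left_mono[OF cb(1)[of k y], of "norm y"] by simp
      ultimately have "norm (E k y) \<le> 4 * norm y" using E_le[of k y] by linarith
      have "norm (g y \<bullet> (v y *s (\<i> *s E k y))) \<le> norm (g y) * norm (v y *s (\<i> *s E k y))"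
        using Cauchy_Schwarz_ineq2 by simp
      also have "\<dots> = norm (g y) * (norm (v y) * norm (E k y))"
        by (simp add: norm_smult norm_mult)
      also have "\<dots> \<le> norm (g y) * (norm (v y) * (4 * norm y))"
        using \<open>norm (E k y) \<le> 4 * norm y\<close> by (intro mult_left_mono) auto
      finally show "norm (g y \<bullet> (v y *s (\<i> *s E k y))) \<le> 4 * (norm (g y) * norm (norm y *\<^sub>R v y))"
        by (simp add: mult_ac)
    qed
  qed measurable
  then have "(\<integral>y. g y \<bullet> (v y *s (\<i> *s L y)) \<partial>lborel) = 0"
    unfolding zero by (simp add: LIMSEQ_const_iff)
  moreover have "g y \<bullet> (v y *s (\<i> *s L y)) = y $ i * (g y $ j \<bullet> (\<i> * v y)) + y $ j * (g y $ i \<bullet> (\<i> * v y))" for y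
  proof -
    have "v y *s (\<i> *s L y) = axis j (y $ i *\<^sub>R (\<i> * v y)) + axis i (y $ j *\<^sub>R (\<i> * v y))"
      by (simp add: L_def vec_eq_iff axis_def scaleR_conv_of_real)
    then show ?thesis by (simp add: inner_add_right inner_axis)
  qed
  ultimately have "moment i j + moment j i = 0"
    using moment_integrable by (simp add: moment_def)
  then show ?thesis by simp
qed

lemma magnetic_moment_eq:
  "magnetic_moment v g = (1 / 2) *\<^sub>R (\<Sum>j\<in>UNIV. \<Sum>i\<in>UNIV. moment i j *\<^sub>R wedge (axis i 1) (axis j 1))"
proof -
  have "(g y $ j \<bullet> (\<i> * v y)) *\<^sub>R wedge y (axis j 1)
     = (\<Sum>i\<in>UNIV. (y $ i * (g y $ j \<bullet> (\<i> * v y))) *\<^sub>R wedge (axis i 1) (axis j 1))" for y j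
    by (subst wedge_expand) (simp add: scaleR_right.sum mult.commute)
  then have "(\<integral>y. (\<Sum>j\<in>UNIV. (g y $ j \<bullet> (\<i> * v y)) *\<^sub>R wedge y (axis j 1)) \<partial>lborel)
     = (\<Sum>j\<in>UNIV. \<Sum>i\<in>UNIV. moment i j *\<^sub>R wedge (axis i 1) (axis j 1))"
    using moment_integrable by (simp add: moment_def Bochner_Integration.integral_sum)
  then show ?thesis by (simp add: magnetic_moment_def)
qed

text \<open>Let a_ij be the entries of \<open>diffl A x\<close> and m_ij the moments. In the
  convention for bivectors, dA paired with the wedge of e_i and e_j is 2 (a_ij - a_ji); with the
  factor 1 / 2 of \<open>magnetic_moment\<close> this leaves the sum of (a_ij - a_ji) m_ij.
  Antisymmetry of m makes the two halves equal, so DA itself can stand for dA.\<close>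

lemma pairing_magnetic_moment:
  "pairing (ext_deriv A x) (magnetic_moment v g)
     = 2 * (\<Sum>i\<in>UNIV. \<Sum>j\<in>UNIV. diffl A x (axis i 1) (axis j 1) * moment i j)"
proof -
  have "bilinear (ext_deriv A x)"
    unfolding bilinear_def ext_deriv_def
    by (auto intro!: linearI simp: blinfun.add_left blinfun.add_right blinfun.scaleR_left blinfun.scaleR_right algebra_simps)
  note w = pairing_wedge[OF this]
  let ?a = "\<lambda>i j. diffl A x (axis i 1) (axis j 1)"
  have "pairing (ext_deriv A x) (magnetic_moment v g)
     = 1 / 2 * (\<Sum>j\<in>UNIV. \<Sum>i\<in>UNIV. moment i j * (2 * (?a i j - ?a j i)))"
    unfolding magnetic_moment_eq pairing_scaleR pairing_sum w by (simp add: ext_deriv_def)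
  also have "\<dots> = (\<Sum>j\<in>UNIV. \<Sum>i\<in>UNIV. ?a i j * moment i j) - (\<Sum>j\<in>UNIV. \<Sum>i\<in>UNIV. ?a j i * moment i j)"
    by (simp add: sum_distrib_left algebra_simps sum_subtractf)
  also have "(\<Sum>j\<in>UNIV. \<Sum>i\<in>UNIV. ?a j i * moment i j) = - (\<Sum>j\<in>UNIV. \<Sum>i\<in>UNIV. ?a j i * moment j i)"
  proof -
    have "?a j i * moment i j = - (?a j i * moment j i)" for i j
      using moment_antisym[of i j] by simp
    then show ?thesis by (simp only: sum_negf)
  qed
  also have "(\<Sum>j\<in>UNIV. \<Sum>i\<in>UNIV. ?a i j * moment i j) = (\<Sum>i\<in>UNIV. \<Sum>j\<in>UNIV. ?a i j * moment i j)"
    by (rule sum.swap)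
  finally show ?thesis by simp
qed

text \<open>With \<open>v\<close> fixed, the squared norm is exactly a quadratic polynomial in the
  entries of \<open>b\<close> and affine in \<open>W\<close>, so its differential can be read off
  from the coefficients: first moments of the current, second moments of |v|^2, all finite by the
  decay.\<close>

lemma normsq_change_potential:
  fixes b :: "'n potential"
  shows "H1_normsq W (v, \<lambda>y. g y + v y *s potvec b y)
    = N + (W - V) * charge v + 2 * (\<Sum>i\<in>UNIV. \<Sum>j\<in>UNIV. b (axis i 1) (axis j 1) * moment i j)
      + (\<Sum>j\<in>UNIV. \<Sum>i\<in>UNIV. \<Sum>k\<in>UNIV. b (axis i 1) (axis j 1) * b (axis k 1) (axis j 1)
          * (\<integral>y. (y $ i *\<^sub>R v y) \<bullet> (y $ k *\<^sub>R v y) \<partial>lborel))"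
proof -
  let ?b = "\<lambda>i j. blinfun_apply (blinfun_apply b (axis i 1)) (axis j 1)"
  have b_apply: "blinfun_apply (blinfun_apply b y) (axis j 1) = (\<Sum>i\<in>UNIV. y $ i * ?b i j)" for y j
  proof -
    have "y = (\<Sum>i\<in>UNIV. y $ i *\<^sub>R axis i 1)"
      using basis_expansion[of y] by (simp add: scalar_mult_eq_scaleR)
    then have "blinfun_apply (blinfun_apply b y) (axis j 1)
      = blinfun_apply (blinfun_apply b (\<Sum>i\<in>UNIV. y $ i *\<^sub>R axis i 1)) (axis j 1)" by simp
    also have "\<dots> = (\<Sum>i\<in>UNIV. y $ i * ?b i j)"
      by (simp add: blinfun.sum_right blinfun.sum_left blinfun.scaleR_left blinfun.scaleR_right)
    finally show ?thesis .
  qed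
  have comp: "(v y *s potvec b y) $ j = (\<Sum>i\<in>UNIV. y $ i * ?b i j) *\<^sub>R (\<i> * v y)" for y j
    unfolding b_apply[symmetric] by (simp add: potvec_def scaleR_conv_of_real mult_ac)
  have cross: "g y \<bullet> (v y *s potvec b y) = (\<Sum>i\<in>UNIV. \<Sum>j\<in>UNIV. ?b i j * (y $ i * (g y $ j \<bullet> (\<i> * v y))))" for y
  proof -
    have "g y \<bullet> (v y *s potvec b y) = (\<Sum>j\<in>UNIV. \<Sum>i\<in>UNIV. ?b i j * (y $ i * (g y $ j \<bullet> (\<i> * v y))))"
      unfolding inner_vec_def[of "g y"] comp by (simp add: sum_distrib_left mult_ac)
    also have "\<dots> = (\<Sum>i\<in>UNIV. \<Sum>j\<in>UNIV. ?b i j * (y $ i * (g y $ j \<bullet> (\<i> * v y))))"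
      by (rule sum.swap)
    finally show ?thesis .
  qed
  have sq: "(norm (v y *s potvec b y))\<^sup>2
      = (\<Sum>j\<in>UNIV. \<Sum>i\<in>UNIV. \<Sum>k\<in>UNIV. ?b i j * ?b k j * ((y $ i *\<^sub>R v y) \<bullet> (y $ k *\<^sub>R v y)))" for y
    unfolding power2_norm_eq_inner inner_vec_def[of "v y *s potvec b y"] comp
    by (simp add: inner_complex_def sum_distrib_left sum_distrib_right sum_product sum.distrib algebra_simps)
  have "H1_normsq W (v, \<lambda>y. g y + v y *s potvec b y)
     = (\<integral>y. ((norm (g y))\<^sup>2 + W * (norm (v y))\<^sup>2) + 2 * (g y \<bullet> (v y *s potvec b y)) + (norm (v y *s potvec b y))\<^sup>2 \<partial>lborel)"
    unfolding H1_normsq_def prod.case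
    by (intro Bochner_Integration.integral_cong refl)
       (simp add: power2_norm_eq_inner inner_add_left inner_add_right inner_commute[of "v y *s potvec b y" "g y" for y])
  also have "\<dots> = H1_normsq W (v, g) + 2 * (\<integral>y. g y \<bullet> (v y *s potvec b y) \<partial>lborel) + (\<integral>y. (norm (v y *s potvec b y))\<^sup>2 \<partial>lborel)"
  proof -
    have "integrable lborel (\<lambda>y. g y \<bullet> (v y *s potvec b y))"
      unfolding cross using moment_integrable by simp
    moreover have "integrable lborel (\<lambda>y. (norm (v y *s potvec b y))\<^sup>2)"
      unfolding sq using L2_integrable_inner[OF coord_L2 coord_L2] by (intro Bochner_Integration.integrable_sum integrable_mult_right)
    ultimately show ?thesis
      using L2[THEN L2_integrable] by (simp add: H1_normsq_def)
  qed
  also have "(\<integral>y. g y \<bullet> (v y *s potvec b y) \<partial>lborel) = (\<Sum>i\<in>UNIV. \<Sum>j\<in>UNIV. ?b i j * moment i j)"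
    unfolding cross moment_def using moment_integrable by (simp add: Bochner_Integration.integral_sum)
  also have "(\<integral>y. (norm (v y *s potvec b y))\<^sup>2 \<partial>lborel)
      = (\<Sum>j\<in>UNIV. \<Sum>i\<in>UNIV. \<Sum>k\<in>UNIV. ?b i j * ?b k j * (\<integral>y. (y $ i *\<^sub>R v y) \<bullet> (y $ k *\<^sub>R v y) \<partial>lborel))"
    unfolding sq using L2_integrable_inner[OF coord_L2 coord_L2]
    by (simp only: Bochner_Integration.integral_sum Bochner_Integration.integrable_sum integrable_mult_right integral_mult_right_zero)
  also have "H1_normsq W (v, g) = N + (W - V) * charge v"
    using normsq_eq by (simp add: H1_normsq_eq[OF L2] charge_def algebra_simps)
  finally show ?thesis .
qed

end

section \<open>The first-order condition at the minimum point\<close>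

theorem proposition3p5:
  fixes \<Omega> :: "(real^'n::finite) set"
    and V :: "real^'n \<Rightarrow> real"
    and A :: "real^'n \<Rightarrow> ((real^'n) \<Rightarrow>\<^sub>L real)"
    and p :: real
    and xs :: "real^'n"
    and v :: "real^'n \<Rightarrow> complex"
    and Dv :: "real^'n \<Rightarrow> complex^'n"
  assumes "p > 0"
    and "1 / 2 - 1 / real CARD('n) < 1 / p" and "1 / p < 1 / 2"
    and "open \<Omega>"
    and "C1_on \<Omega> V" and "\<And>x. x \<in> \<Omega> \<Longrightarrow> V x > 0"
    and "C2_on \<Omega> A"
    and "xs \<in> \<Omega>"
    and "\<forall>\<^sub>F x in at xs within \<Omega>.
           ground_energy p (V xs) (diffl A xs) \<le> ground_energy p (V x) (diffl A x)"
    and "(v, Dv) \<in> H1 (V xs) (diffl A xs)"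
    and "achieves_ground_energy p (V xs) (diffl A xs) (v, Dv)"
  shows "charge v *\<^sub>R diffl V xs
         + diffl (\<lambda>x. pairing (ext_deriv A x) (magnetic_moment v Dv)) xs = 0"
proof -
  define N where "N = H1_normsq (V xs) (v, Dv)"
  have p: "p > 2" using assms(1,3) by (simp add: field_simps)
  note Vxs = assms(6)[OF assms(8)]
  have nehari: "\<not> (AE y in lborel. v y = 0)" "N = lp_int p v"
    and energy: "action p (V xs) (v, Dv) = ground_energy p (V xs) (diffl A xs)"
    using assms(1,11) by (auto simp: achieves_ground_energy_def nehari_iff N_def)
  have ground: "(1 / 2 - 1 / p) * N = ground_energy p (V xs) (diffl A xs)"
    using energy nehari(2) by (simp add: action_eq algebra_simps flip: N_def)
  have "N > 0"
    unfolding N_def using Vxs assms(10) nehari(1) by (rule H1_normsq_pos)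
  interpret ground_state p "V xs" "diffl A xs" v Dv N
    using p Vxs assms(10) \<open>N > 0\<close> nehari(2) ground by unfold_locales (simp_all add: N_def)

  \<comment> \<open>The competitor \<open>v\<close> at the point \<open>x\<close>: its covariant
    derivative for \<open>diffl A x\<close> is written as a correction of \<open>Dv\<close>.\<close>
  define f where "f x = H1_normsq (V x) (v, \<lambda>y. Dv y + v y *s potvec (diffl A x - diffl A xs) y)" for x
  have f_xs: "f xs = N" by (simp add: f_def N_def)
  \<comment> \<open>The L^p integral of \<open>v\<close> does not depend on \<open>x\<close> and
    stays equal to \<open>N\<close>, so a ground-energy that is no smaller forces a norm that is no
    smaller.\<close>
  have f_ge: "N \<le> f x"
    if "x \<in> \<Omega>" "ground_energy p (V xs) (diffl A xs) \<le> ground_energy p (V x) (diffl A x)" for x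
  proof -
    have "(v, \<lambda>y. Dv y + v y *s potvec (diffl A x - diffl A xs) y)
        \<in> H1 (V x) (diffl A xs + (diffl A x - diffl A xs))"
      using Vxs assms(6)[OF that(1)] assms(10) norm_L2 by (rule H1_change_potential)
    then have "(v, \<lambda>y. Dv y + v y *s potvec (diffl A x - diffl A xs) y) \<in> H1 (V x) (diffl A x)"
      by simp
    moreover have "(1 / 2 - 1 / p) * N \<le> ground_energy p (V x) (diffl A x)"
      using ground that(2) by simp
    ultimately show ?thesis
      unfolding f_def using p assms(6)[OF that(1)] \<open>N > 0\<close> nehari(2)
      by (intro normsq_ge_of_ground_energy) auto
  qed
  obtain S where S: "open S" "xs \<in> S" and
    S_le: "\<And>x. x \<in> S \<Longrightarrow> x \<noteq> xs \<Longrightarrow> ground_energy p (V xs) (diffl A xs) \<le> ground_energy p (V x) (diffl A x)"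
    using assms(9) unfolding at_within_open[OF assms(8,4)] eventually_at_topological by blast
  \<comment> \<open>The filter excludes \<open>xs\<close> itself, where there is equality.\<close>
  have f_min: "\<forall>x\<in>S \<inter> \<Omega>. f xs \<le> f x"
    using f_ge S_le f_xs by (metis IntE order_refl)

  define D where "D = blinfun_apply (diffl (diffl A) xs)"
  have "diffl A differentiable (at xs)"
    using assms(7,8) by (simp add: C2_on_def C1_on_def)
  then have "(diffl A has_derivative D) (at xs)"
    unfolding D_def by (rule has_derivative_diffl)
  then have dA: "((\<lambda>x. blinfun_apply (blinfun_apply (diffl A x) c) e) has_derivative (\<lambda>h. D h c e)) (at xs)" for c e
    by (intro bounded_linear.has_derivative[OF blinfun.bounded_linear_left])
  have dV: "(V has_derivative diffl V xs) (at xs)"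
    using assms(5,8) by (intro has_derivative_diffl) (simp add: C1_on_def)
  let ?L = "\<lambda>h. 2 * (\<Sum>i\<in>UNIV. \<Sum>j\<in>UNIV. D h (axis i 1) (axis j 1) * moment i j)"
  \<comment> \<open>The same \<open>?L\<close> occurs in the differential of \<open>f\<close>,
    factor 2 included; the factor comes from the bivector convention here and from the cross term of
    the square there.\<close>
  have dT: "((\<lambda>x. pairing (ext_deriv A x) (magnetic_moment v Dv)) has_derivative ?L) (at xs)"
    unfolding pairing_magnetic_moment
    by (intro has_derivative_mult_right has_derivative_sum has_derivative_mult_left dA)
  have df: "(f has_derivative (\<lambda>h. diffl V xs h * charge v + ?L h)) (at xs)"
  proof -
    define b where "b i j x = blinfun_apply (blinfun_apply (diffl A x - diffl A xs) (axis i 1)) (axis j 1)" for i j x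
    have b: "(b i j has_derivative (\<lambda>h. D h (axis i 1) (axis j 1))) (at xs)" for i j
      unfolding b_def[abs_def] blinfun.diff_left
      by (rule has_derivative_eq_rhs[OF has_derivative_diff[OF dA has_derivative_const]]) simp
    have b0: "b i j xs = 0" for i j by (simp add: b_def)
    \<comment> \<open>Both factors vanish at \<open>xs\<close>, so the part quadratic in the change
      of potential has differential 0.\<close>
    have bb: "((\<lambda>x. b i j x * b k j x * c) has_derivative (\<lambda>h. 0)) (at xs)" for i j k c
      by (rule has_derivative_eq_rhs[OF has_derivative_mult_left[OF has_derivative_mult[OF b b]]]) (simp add: b0)
    have "f = (\<lambda>x. N + (V x - V xs) * charge v + 2 * (\<Sum>i\<in>UNIV. \<Sum>j\<in>UNIV. b i j x * moment i j)
        + (\<Sum>j\<in>UNIV. \<Sum>i\<in>UNIV. \<Sum>k\<in>UNIV. b i j x * b k j x * (\<integral>y. (y $ i *\<^sub>R v y) \<bullet> (y $ k *\<^sub>R v y) \<partial>lborel)))"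
      unfolding f_def[abs_def] b_def normsq_change_potential ..
    moreover have "(\<dots> has_derivative (\<lambda>h. 0 + (diffl V xs h - 0) * charge v
        + 2 * (\<Sum>i\<in>UNIV. \<Sum>j\<in>UNIV. D h (axis i 1) (axis j 1) * moment i j)
        + (\<Sum>j\<in>(UNIV::'n set). \<Sum>i\<in>(UNIV::'n set). \<Sum>k\<in>(UNIV::'n set). 0))) (at xs)"
      by (intro has_derivative_add has_derivative_const has_derivative_diff has_derivative_mult_right
            has_derivative_mult_left has_derivative_sum b bb dV)
    ultimately show ?thesis by simp
  qed
  have "(\<lambda>h. diffl V xs h * charge v + ?L h) = (\<lambda>h. 0)"
    by (rule differential_zero_maxmin[OF _ _ df, of "S \<inter> \<Omega>"]) (use S assms(4,8) f_min in auto)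
  then have "diffl V xs h * charge v + ?L h = 0" for h
    by meson
  then show ?thesis
    by (intro blinfun_eqI) (simp add: blinfun.add_left blinfun.scaleR_left diffl_unique[OF dT] mult.commute)
qed

end
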